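(* If $\sigma\in\mathfrak{S}_n$ is 132-avoiding, then for all $w\in\mathcal{R}(\sigma)$ the tableau $P(w)$ is frozen and has the same shape $\lambda(\sigma)$. Furthermore, each shape $\lambda\subset \mathrm{sc}_n$ appears (as $\lambda=\lambda(\sigma)$) for exactly one $\sigma\in\mathfrak{S}_n(132)$. Hence, $w\mapsto \mathrm{EG}(w)=Q(w)$ defines, for every 132-avoiding $\sigma \in \mathfrak{S}_n$, a bijection $$\mathcal{R}(\sigma)\to \mathrm{SYT}(\lambda(\sigma)),$$ and a bijection $$\bigcup_{\sigma\in\mathfrak{S}_n(132)}\mathcal{R}(\sigma)\to\bigcup_{\lambda\subset\mathrm{sc}_n}\mathrm{SYT}(\lambda).$$
   Context: Words and permutations. A word $w = w_1\cdots w_m$ with letters in $[n-1]$ defines the permutation $\sigma = s_{w_1}\cdots s_{w_m}\in\mathfrak{S}_n$, where $s_i=(i\ i{+}1)$ and transpositions act on positions, composed from the left: start with the one-line word $12\cdots n$ and for $k=1,\dots,m$ swap the entries in positions $w_k$ and $w_k+1$ (e.g. $1213$ gives $3241$). The word is reduced if $m = \mathrm{inv}(\sigma)$; $\mathcal{R}(\sigma)$ is the set of reduced words of $\sigma$. $\mathfrak{S}_n(132)$ is the set of 132-avoiding permutations in $\mathfrak{S}_n$, i.e. those whose one-line word has no subsequence in the same relative order as $132$. Edelman--Greene correspondence. Tableaux are in English notation, cell $(i,j)$ in row $i$ and column $j$. To insert $x_0$ into a tableau $P$ with strictly increasing rows $P_1,P_2,\dots$ (rows beyond the last are empty), do for $i=0,1,2,\dots$: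 if $x_i>z$ for all $z\in P_{i+1}$, place $x_i$ at the end of $P_{i+1}$ and stop; if $x_i\in P_{i+1}$, leave row $P_{i+1}$ unchanged and insert $x_{i+1}=x_i+1$ in $P_{i+2}$; otherwise let $z'$ be the least element of $P_{i+1}$ with $z'>x_i$, replace it by $x_i$, and insert $x_{i+1}=z'$ in $P_{i+2}$. For a word $w=w_1\cdots w_m$, let $P^{(0)}=\emptyset$ and let $P^{(k)}$ be the result of inserting $w_k$ in $P^{(k-1)}$. Set $P(w)=P^{(m)}$ (insertion tableau), and let $Q(w)=\mathrm{EG}(w)$ (recording tableau) be the tableau of the same shape with entry $k$ in the unique cell of $P^{(k)}\setminus P^{(k-1)}$. $P(w)$ is frozen if $P(w)_{i,j}=i+j-1$ for every cell $(i,j)$ of it. Shapes. $\mathrm{sc}_n=(n-1,n-2,\dots,1)$ is the staircase partition; $\lambda\subset\mathrm{sc}_n$ means containment of Young diagrams ($\lambda$ possibly empty). $\mathrm{SYT}(\lambda)$ is the set of standard Young tableaux of shape $\lambda$. The permutation matrix of $\sigma$ has 1s exactly in entries $(\sigma(i),i)$ (row $\sigma(i)$, column $i$); the (Rothe) diagram $D(\sigma)$ is the set of cells not weakly east (in the same row) nor weakly south (in the same column) of a 1-entry, i.e. $D(\sigma)=\{(r,c): r<\sigma(c),\ c<\sigma^{-1}(r)\}$. The (possibly empty) connected component of $D(\sigma)$ containing $(1,1)$ (cells adjacent when sharing an edge) is the Young diagram of a partition denoted $\lambda(\sigma)$. *)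

theory Defs
  imports "HOL-Combinatorics.Permutations"
begin

section \<open>Permutations and reduced words\<close>

text \<open>
  A permutation \<open>\<sigma>\<close> of \<open>[n]\<close> is a function with \<open>\<sigma> permutes {1..n}\<close>; its one-line word is
  \<open>\<sigma> 1, \<dots>, \<sigma> n\<close>. Composing with \<open>s\<^sub>k\<close> on the right swaps the entries in positions
  \<open>k\<close> and \<open>k + 1\<close>.
\<close>

definition word_perm :: "nat list \<Rightarrow> nat \<Rightarrow> nat" where
  "word_perm w = foldl (\<lambda>\<sigma> k. \<sigma> \<circ> transpose k (k + 1)) id w"

definition inv_number :: "nat \<Rightarrow> (nat \<Rightarrow> nat) \<Rightarrow> nat" where
  "inv_number n \<sigma> = card {(i, j). 1 \<le> i \<and> i < j \<and> j \<le> n \<and> \<sigma> j < \<sigma> i}"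

definition reduced_words :: "nat \<Rightarrow> (nat \<Rightarrow> nat) \<Rightarrow> nat list set" where
  "reduced_words n \<sigma> =
     {w. set w \<subseteq> {1..n - 1} \<and> word_perm w = \<sigma> \<and> length w = inv_number n \<sigma>}"

definition avoids_132 :: "nat \<Rightarrow> (nat \<Rightarrow> nat) \<Rightarrow> bool" where
  "avoids_132 n \<sigma> \<longleftrightarrow>
     \<not> (\<exists>i j k. 1 \<le> i \<and> i < j \<and> j < k \<and> k \<le> n \<and> \<sigma> i < \<sigma> k \<and> \<sigma> k < \<sigma> j)"

definition perms_132 :: "nat \<Rightarrow> (nat \<Rightarrow> nat) set" where
  "perms_132 n = {\<sigma>. \<sigma> permutes {1..n} \<and> avoids_132 n \<sigma>}"


section \<open>Partitions and tableaux\<close>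

text \<open>
  Cells are pairs (row, column), both counted from 1. A tableau is the list of its rows.
\<close>

definition is_partition :: "nat list \<Rightarrow> bool" where
  "is_partition \<mu> \<longleftrightarrow> sorted_wrt (\<ge>) \<mu> \<and> 0 \<notin> set \<mu>"

definition young_diagram :: "nat list \<Rightarrow> (nat \<times> nat) set" where
  "young_diagram \<mu> = {(i, j). 1 \<le> i \<and> i \<le> length \<mu> \<and> 1 \<le> j \<and> j \<le> \<mu> ! (i - 1)}"

definition staircase :: "nat \<Rightarrow> nat list" where
  "staircase n = rev [1..<n]"

definition partitions_in_staircase :: "nat \<Rightarrow> nat list set" where
  "partitions_in_staircase n =
     {\<mu>. is_partition \<mu> \<and> young_diagram \<mu> \<subseteq> young_diagram (staircase n)}"

definition tab_shape :: "nat list list \<Rightarrow> nat list" where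
  "tab_shape T = map length T"

abbreviation cells :: "nat list list \<Rightarrow> (nat \<times> nat) set" where
  "cells T \<equiv> young_diagram (tab_shape T)"

definition entry :: "nat list list \<Rightarrow> nat \<Rightarrow> nat \<Rightarrow> nat" where
  "entry T i j = T ! (i - 1) ! (j - 1)"

definition SYT :: "nat list \<Rightarrow> nat list list set" where
  "SYT \<mu> = {T. tab_shape T = \<mu> \<and>
     bij_betw (\<lambda>(i, j). entry T i j) (young_diagram \<mu>) {1..sum_list \<mu>} \<and>
     (\<forall>i j. (i, j) \<in> young_diagram \<mu> \<and> (i, j + 1) \<in> young_diagram \<mu> \<longrightarrow>
        entry T i j < entry T i (j + 1)) \<and>
     (\<forall>i j. (i, j) \<in> young_diagram \<mu> \<and> (i + 1, j) \<in> young_diagram \<mu> \<longrightarrow>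
        entry T i j < entry T (i + 1) j)}"

definition frozen :: "nat list list \<Rightarrow> bool" where
  "frozen T \<longleftrightarrow> (\<forall>(i, j) \<in> cells T. entry T i j = i + j - 1)"


section \<open>The Edelman--Greene correspondence\<close>

fun eg_insert :: "nat \<Rightarrow> nat list list \<Rightarrow> nat list list" where
  "eg_insert x [] = [[x]]"
| "eg_insert x (R # Rs) =
     (if \<forall>z \<in> set R. z < x then (R @ [x]) # Rs
      else if x \<in> set R then R # eg_insert (x + 1) Rs
      else let z' = Min {z \<in> set R. x < z}
           in map (\<lambda>z. if z = z' then x else z) R # eg_insert z' Rs)"

definition P_tab :: "nat list \<Rightarrow> nat list list" where
  "P_tab w = foldl (\<lambda>P x. eg_insert x P) [] w"

text \<open>
  \<open>P_tab (take k w)\<close> is the tableau after \<open>k\<close> insertions, so the entry of the recording tableau in a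
  cell is the step at which this cell is created.
\<close>

definition EG :: "nat list \<Rightarrow> nat list list" where
  "EG w =
     map (\<lambda>i. map (\<lambda>j. THE k. 1 \<le> k \<and> k \<le> length w \<and>
                       (i, j) \<in> cells (P_tab (take k w)) - cells (P_tab (take (k - 1) w)))
                  [1..<tab_shape (P_tab w) ! (i - 1) + 1])
         [1..<length (P_tab w) + 1]"


section \<open>The shape attached to a permutation\<close>

definition rothe_diagram :: "nat \<Rightarrow> (nat \<Rightarrow> nat) \<Rightarrow> (nat \<times> nat) set" where
  "rothe_diagram n \<sigma> = {(r, c). r \<in> {1..n} \<and> c \<in> {1..n} \<and> r < \<sigma> c \<and> c < inv \<sigma> r}"

definition adjacent :: "nat \<times> nat \<Rightarrow> nat \<times> nat \<Rightarrow> bool" where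
  "adjacent = (\<lambda>(r, c) (r', c').
     (r = r' \<and> (c' = c + 1 \<or> c = c' + 1)) \<or> (c = c' \<and> (r' = r + 1 \<or> r = r' + 1)))"

text \<open>The guard \<open>(1, 1) \<in> D\<close> makes the component empty when \<open>D\<close> does not contain \<open>(1, 1)\<close>.\<close>

definition corner_component :: "(nat \<times> nat) set \<Rightarrow> (nat \<times> nat) set" where
  "corner_component D =
     {x. (1, 1) \<in> D \<and> ((1, 1), x) \<in> {(a, b). a \<in> D \<and> b \<in> D \<and> adjacent a b}\<^sup>*}"

definition lambda_shape :: "nat \<Rightarrow> (nat \<Rightarrow> nat) \<Rightarrow> nat list" where
  "lambda_shape n \<sigma> =
     (THE \<mu>. is_partition \<mu> \<and> young_diagram \<mu> = corner_component (rothe_diagram n \<sigma>))"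

text \<open>The description defining \<open>lambda_shape\<close> denotes for every permutation of \<open>[n]\<close>.\<close>

lemma young_diagram_length_le:
  assumes "0 \<notin> set \<mu>" "young_diagram \<mu> \<subseteq> young_diagram \<nu>"
  shows "length \<mu> \<le> length \<nu>"
proof (cases "\<mu> = []")
  case False
  then have "\<mu> ! (length \<mu> - 1) \<in> set \<mu>"
    by (intro nth_mem) simp
  then have "\<mu> ! (length \<mu> - 1) \<noteq> 0"
    using assms(1) by metis
  then have "(length \<mu>, 1) \<in> young_diagram \<mu>"
    using False by (simp add: young_diagram_def Suc_le_eq)
  then have "(length \<mu>, 1) \<in> young_diagram \<nu>"
    using assms(2) by blast
  then show ?thesis by (simp add: young_diagram_def)
qed simp

lemma young_diagram_nth_le:
  assumes "young_diagram \<mu> \<subseteq> young_diagram \<nu>" "i < length \<mu>"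
  shows "\<mu> ! i \<le> \<nu> ! i"
proof (cases "\<mu> ! i = 0")
  case False
  then have "(Suc i, \<mu> ! i) \<in> young_diagram \<mu>"
    using assms(2) by (simp add: young_diagram_def)
  then have "(Suc i, \<mu> ! i) \<in> young_diagram \<nu>"
    using assms(1) by blast
  then show ?thesis by (simp add: young_diagram_def)
qed simp

lemma young_diagram_inj:
  assumes "is_partition \<mu>" "is_partition \<nu>" "young_diagram \<mu> = young_diagram \<nu>"
  shows "\<mu> = \<nu>"
proof (rule nth_equalityI)
  show len: "length \<mu> = length \<nu>"
    using assms young_diagram_length_le[of \<mu> \<nu>] young_diagram_length_le[of \<nu> \<mu>]
    by (simp add: is_partition_def)
  show "\<mu> ! i = \<nu> ! i" if "i < length \<mu>" for i
    using assms(3) len that young_diagram_nth_le[of \<mu> \<nu> i] young_diagram_nth_le[of \<nu> \<mu> i]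
    by simp
qed

lemma young_diagram_exists:
  fixes C :: "(nat \<times> nat) set"
  assumes sub: "C \<subseteq> {1..n} \<times> {1..n}"
    and down: "\<And>r c r' c'. (r, c) \<in> C \<Longrightarrow> 1 \<le> r' \<Longrightarrow> r' \<le> r \<Longrightarrow> 1 \<le> c' \<Longrightarrow> c' \<le> c \<Longrightarrow> (r', c') \<in> C"
  shows "\<exists>\<mu>. is_partition \<mu> \<and> young_diagram \<mu> = C"
proof -
  have initial: "A = {1..card A}"
    if "A \<subseteq> {1..n}" "\<And>a b. a \<in> A \<Longrightarrow> 1 \<le> b \<Longrightarrow> b \<le> a \<Longrightarrow> b \<in> A" for A :: "nat set"
  proof (cases "A = {}")
    case False
    have fin: "finite A" using that(1) finite_subset by blast
    have "A = {1..Max A}"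
    proof
      show "A \<subseteq> {1..Max A}" using that(1) fin by auto
      show "{1..Max A} \<subseteq> A" using that(2)[OF Max_in[OF fin False]] by auto
    qed
    then show ?thesis by (metis card_atLeastAtMost diff_Suc_1)
  qed simp
  define h where "h = card {r. (r, 1) \<in> C}"
  define row where "row r = card {c. (r, c) \<in> C}" for r
  have col: "{r. (r, 1) \<in> C} = {1..h}"
    unfolding h_def by (rule initial) (use sub down in \<open>blast+\<close>)
  have rows: "{c. (r, c) \<in> C} = {1..row r}" for r
    unfolding row_def
  proof (rule initial)
    show "{c. (r, c) \<in> C} \<subseteq> {1..n}" using sub by blast
    fix a b assume a: "a \<in> {c. (r, c) \<in> C}" "1 \<le> b" "b \<le> a"
    moreover have "1 \<le> r" using a sub by fastforce
    ultimately show "b \<in> {c. (r, c) \<in> C}" using down[of r a r b] by simp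
  qed
  have mem: "(r, c) \<in> C \<longleftrightarrow> 1 \<le> c \<and> c \<le> row r" for r c
    using rows[of r] by (metis atLeastAtMost_iff mem_Collect_eq)
  have mem1: "1 \<le> r \<and> r \<le> h" if "(r, c) \<in> C" for r c
  proof -
    have "1 \<le> r" "1 \<le> c" using that sub by auto
    then have "(r, 1) \<in> C" using down[OF that, of r 1] by simp
    then show ?thesis using col by (metis atLeastAtMost_iff mem_Collect_eq)
  qed
  define \<mu> where "\<mu> = map (\<lambda>i. row (Suc i)) [0..<h]"
  have "young_diagram \<mu> = C"
  proof (intro set_eqI)
    fix x show "x \<in> young_diagram \<mu> \<longleftrightarrow> x \<in> C"
    proof (cases x)
      case (Pair r c)
      show ?thesis unfolding Pair
        using mem[of r c] mem1[of r c] by (auto simp: young_diagram_def \<mu>_def)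
    qed
  qed
  moreover have "0 \<notin> set \<mu>"
  proof
    assume "0 \<in> set \<mu>"
    then obtain i where i: "i < h" "row (Suc i) = 0" by (auto simp: \<mu>_def)
    then have "Suc i \<in> {r. (r, 1) \<in> C}" unfolding col by simp
    with i mem[of "Suc i" 1] show False by simp
  qed
  moreover have "row (Suc j) \<le> row (Suc i)" if "i < j" for i j
  proof (cases "row (Suc j) = 0")
    case False
    then have "(Suc j, row (Suc j)) \<in> C" using mem by simp
    then have "(Suc i, row (Suc j)) \<in> C" by (rule down) (use that False in auto)
    then show ?thesis using mem by simp
  qed simp
  then have "sorted_wrt (\<ge>) \<mu>"
    by (auto simp: \<mu>_def sorted_wrt_iff_nth_less)
  ultimately show ?thesis unfolding is_partition_def by blast
qed

lemma corner_component_subset: "corner_component D \<subseteq> D"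
  unfolding corner_component_def by (auto elim: rtranclE)

lemma corner_component_rothe_down:
  assumes \<sigma>: "\<sigma> permutes {1..n}"
    and "(r, c) \<in> corner_component (rothe_diagram n \<sigma>)"
    and "1 \<le> r'" "r' \<le> r" "1 \<le> c'" "c' \<le> c"
  shows "(r', c') \<in> corner_component (rothe_diagram n \<sigma>)"
proof -
  define D where "D = rothe_diagram n \<sigma>"
  define E where "E = {(a, b). a \<in> D \<and> b \<in> D \<and> adjacent a b}"
  define full where "full = (\<lambda>(r, c). {1..r} \<times> {1..c} \<subseteq> D)"
  have inv: "inv \<sigma> (\<sigma> i) = i" "\<sigma> (inv \<sigma> i) = i" for i
    using permutes_inverses[OF \<sigma>] by auto
  have D: "(1, 1) \<in> D" and reach: "((1, 1), (r, c)) \<in> E\<^sup>*"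
    using assms(2) by (auto simp: corner_component_def D_def E_def)
  have inD: "(r, c) \<in> D \<longleftrightarrow> r \<in> {1..n} \<and> c \<in> {1..n} \<and> r < \<sigma> c \<and> c < inv \<sigma> r" for r c
    by (simp add: D_def rothe_diagram_def)
  have right: "full (r, c + 1)" if "full (r, c)" "(r, c) \<in> D" "(r, c + 1) \<in> D" for r c
  proof -
    have "(q, c + 1) \<in> D" if q: "1 \<le> q" "q \<le> r" for q
    proof -
      have "1 \<le> c" using \<open>(r, c) \<in> D\<close> by (simp add: inD)
      then have "(q, c) \<in> D" using \<open>full (r, c)\<close> q by (auto simp: full_def)
      moreover have "q < \<sigma> (c + 1)" using \<open>(r, c + 1) \<in> D\<close> q by (simp add: inD)
      moreover from this have "inv \<sigma> q \<noteq> c + 1" using inv(2)[of q] by auto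
      ultimately show ?thesis using \<open>(r, c + 1) \<in> D\<close> by (simp add: inD)
    qed
    with \<open>full (r, c)\<close> show ?thesis by (fastforce simp: full_def le_Suc_eq subset_iff)
  qed
  have below: "full (r + 1, c)" if "full (r, c)" "(r, c) \<in> D" "(r + 1, c) \<in> D" for r c
  proof -
    have "(r + 1, q) \<in> D" if q: "1 \<le> q" "q \<le> c" for q
    proof -
      have "1 \<le> r" using \<open>(r, c) \<in> D\<close> by (simp add: inD)
      then have "(r, q) \<in> D" using \<open>full (r, c)\<close> q by (auto simp: full_def)
      moreover have "q < inv \<sigma> (r + 1)" using \<open>(r + 1, c) \<in> D\<close> q by (simp add: inD)
      moreover from this have "\<sigma> q \<noteq> r + 1" using inv(1)[of q] by auto
      ultimately show ?thesis using \<open>(r + 1, c) \<in> D\<close> by (simp add: inD)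
    qed
    with \<open>full (r, c)\<close> show ?thesis by (fastforce simp: full_def le_Suc_eq subset_iff)
  qed
  have "full (r, c)"
    using reach
  proof (induction rule: rtrancl_induct)
    case base
    show ?case using D by (auto simp: full_def)
  next
    case (step x y)
    obtain a b a' b' where xy: "x = (a, b)" "y = (a', b')" by (metis surj_pair)
    have "(a, b) \<in> D" "(a', b') \<in> D" "adjacent (a, b) (a', b')"
      using step.hyps(2) by (auto simp: E_def xy)
    then consider "a' = a \<and> b' = b + 1" | "a' = a + 1 \<and> b' = b" | "a' \<le> a" "b' \<le> b"
      by (auto simp: adjacent_def)
    then show ?case
    proof cases
      case 3
      then show ?thesis using step.IH by (auto simp: full_def xy)
    qed (use step.IH right below \<open>(a, b) \<in> D\<close> \<open>(a', b') \<in> D\<close> in \<open>auto simp: xy\<close>)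
  qed
  then have box: "(p, q) \<in> D" if "1 \<le> p" "p \<le> r'" "1 \<le> q" "q \<le> c'" for p q
    using that assms(4,6) by (auto simp: full_def)
  have "((1, 1), (p, 1)) \<in> E\<^sup>*" if "1 \<le> p" "p \<le> r'" for p
    using that
  proof (induction p rule: dec_induct)
    case (step p)
    have "((p, 1), (Suc p, 1)) \<in> E"
      using step box[of p 1] box[of "Suc p" 1] assms(5) by (simp add: E_def adjacent_def)
    with step show ?case by (simp add: rtrancl.rtrancl_into_rtrancl)
  qed simp
  from this[of r'] have "((1, 1), (r', 1)) \<in> E\<^sup>*" using assms(3) by simp
  moreover have "((r', 1), (r', q)) \<in> E\<^sup>*" if "1 \<le> q" "q \<le> c'" for q
    using that
  proof (induction q rule: dec_induct)
    case (step q)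
    have "((r', q), (r', Suc q)) \<in> E"
      using step box[of r' q] box[of r' "Suc q"] assms(3) by (simp add: E_def adjacent_def)
    with step show ?case by (simp add: rtrancl.rtrancl_into_rtrancl)
  qed simp
  from this[of c'] have "((r', 1), (r', c')) \<in> E\<^sup>*" using assms(5) by simp
  ultimately have "((1, 1), (r', c')) \<in> E\<^sup>*" by (rule rtrancl_trans)
  with D show ?thesis by (simp add: corner_component_def D_def E_def)
qed

lemma lambda_shape:
  assumes "\<sigma> permutes {1..n}"
  shows "is_partition (lambda_shape n \<sigma>)"
    and "young_diagram (lambda_shape n \<sigma>) = corner_component (rothe_diagram n \<sigma>)"
proof -
  let ?C = "corner_component (rothe_diagram n \<sigma>)"
  have "?C \<subseteq> {1..n} \<times> {1..n}"
    using corner_component_subset by (fastforce simp: rothe_diagram_def)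
  then have "\<exists>\<mu>. is_partition \<mu> \<and> young_diagram \<mu> = ?C"
    by (rule young_diagram_exists) (rule corner_component_rothe_down[OF assms])
  then have "\<exists>!\<mu>. is_partition \<mu> \<and> young_diagram \<mu> = ?C"
    using young_diagram_inj by blast
  from theI'[OF this] show "is_partition (lambda_shape n \<sigma>)"
    and "young_diagram (lambda_shape n \<sigma>) = ?C"
    unfolding lambda_shape_def by blast+
qed

end

theory Submission
  imports Defs
begin

text \<open>
  Edelman--Greene insertion rewrites words by commutations and braid relations only. Read row by
  row from the bottom, the insertion tableau of a reduced word \<open>w\<close> is therefore again a reduced word
  of the same permutation (\<open>word_perm_P_tab\<close>), and its rows and columns are strictly increasing.
  Insertion can be undone: a tableau with these properties, together with one of its corners,
  determines the tableau before the last insertion and the inserted letter (\<open>eg_uninsert\<close>,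
  \<open>eg_insert_inj\<close>). Peeling off corners in the order prescribed by a standard tableau shows that for
  a fixed insertion tableau \<open>P\<close> the recording map is a bijection from the reduced words with
  insertion tableau \<open>P\<close> onto the standard tableaux of the shape of \<open>P\<close> (\<open>EG_bij_betw\<close>). This holds
  for every permutation.

  Avoidance of 132 enters only to show that \<open>P\<close> is the same for all reduced words of \<open>\<sigma>\<close>. Suppose that
  the first row of \<open>P\<close> is \<open>1, \<dots>, p\<close> followed by a nonempty increasing rest \<open>u\<close> with all letters
  larger than \<open>p + 1\<close>. All lower rows have letters at least 2, so \<open>\<sigma>\<close> has the value 1 at position
  \<open>p + 1\<close>, while the last letter of \<open>u\<close>, being the last letter of a reduced word, is a descent of
  \<open>\<sigma>\<close> further to the right: a 132 pattern. So the first row is \<open>1, \<dots>, p\<close>, and the remaining rows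
  form a tableau of the permutation obtained by moving the value 1 back to the first position, which
  still avoids 132 to the right of this value. Induction on the rows gives that \<open>P\<close> is
  frozen (\<open>eg_tableau_avoiding_frozen\<close>).

  Conversely, a frozen tableau of shape \<open>\<mu>\<close> inside the staircase is built row by row from the bottom,
  each row carrying a new minimal value to the right past as many entries as the row is long. This
  makes it visible that its reading word is reduced, that its permutation avoids 132, and that the
  Rothe diagram of this permutation is the Young diagram of \<open>\<mu>\<close>. Hence the shape and the permutation
  determine each other, and the bijections follow from the one for a fixed insertion tableau.
\<close>

section \<open>Words and their permutations\<close>

lemma word_perm_Nil [simp]: "word_perm [] = id"
  by (simp add: word_perm_def)

lemma word_perm_snoc: "word_perm (w @ [k]) = word_perm w \<circ> transpose k (k + 1)"
  by (simp add: word_perm_def)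

lemma word_perm_append: "word_perm (u @ v) = word_perm u \<circ> word_perm v"
proof (induction v rule: rev_induct)
  case (snoc k v)
  then show ?case
    using word_perm_snoc[of "u @ v" k] by (simp add: word_perm_snoc comp_assoc)
qed simp

lemma word_perm_Cons: "word_perm (k # w) = transpose k (k + 1) \<circ> word_perm w"
  using word_perm_append[of "[k]" w] word_perm_snoc[of "[]" k] by simp

lemma word_perm_fixes:
  assumes "\<forall>k \<in> set w. i \<noteq> k \<and> i \<noteq> k + 1"
  shows "word_perm w i = i"
  using assms by (induction w) (auto simp: word_perm_Cons transpose_def)

lemma word_perm_permutes:
  assumes "set w \<subseteq> {1..n - 1}"
  shows "word_perm w permutes {1..n}"
  using assms
proof (induction w)
  case (Cons k w)
  then have "transpose k (k + 1) permutes {1..n}"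
    by (intro permutes_swap_id) auto
  then show ?case
    using Cons unfolding word_perm_Cons by (intro permutes_compose) auto
qed (simp add: permutes_id)

lemma word_perm_inj: "inj (word_perm w)"
proof (induction w)
  case (Cons k w)
  then show ?case
    unfolding word_perm_Cons by (intro inj_compose) simp_all
qed simp

lemma word_perm_commute:
  assumes "\<forall>a \<in> set A. a + 1 < y \<or> y + 1 < a"
  shows "word_perm (A @ [y]) = word_perm (y # A)"
  using assms
proof (induction A)
  case (Cons a A)
  have "transpose a (a + 1) \<circ> transpose y (y + 1) = transpose y (y + 1) \<circ> transpose a (a + 1)"
    using Cons.prems by (auto simp: transpose_def fun_eq_iff)
  then have "transpose a (a + 1) \<circ> (transpose y (y + 1) \<circ> word_perm A) =
      transpose y (y + 1) \<circ> (transpose a (a + 1) \<circ> word_perm A)"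
    by (simp only: flip: comp_assoc)
  moreover have "word_perm (A @ [y]) = word_perm (y # A)"
    by (rule Cons.IH) (use Cons.prems in simp)
  ultimately show ?case
    by (simp only: word_perm_Cons append_Cons)
qed simp

lemma word_perm_cancel: "word_perm (u @ x # x # v) = word_perm (u @ v)"
proof -
  have "word_perm (x # x # v) = word_perm v"
    by (simp add: word_perm_Cons flip: comp_assoc)
  then show ?thesis
    by (simp only: word_perm_append)
qed

lemma word_perm_braid: "word_perm [x, x + 1, x] = word_perm [x + 1, x, x + 1]"
  by (auto simp: word_perm_Cons transpose_def fun_eq_iff)

lemma inv_number_id [simp]: "inv_number n id = 0"
proof -
  have "{(i, j). 1 \<le> i \<and> i < j \<and> j \<le> n \<and> id j < (id i :: nat)} = {}"
    by auto
  then show ?thesis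
    unfolding inv_number_def by (simp only: card.empty)
qed

text \<open>
  Moving the positions of a pair along the transposition maps the inversions of \<open>\<sigma>\<close> bijectively onto
  those of the new permutation, apart from the pair of swapped positions itself, which becomes an
  inversion.
\<close>

lemma inv_number_ascent:
  assumes "1 \<le> k" "k + 1 \<le> n" "\<sigma> k < \<sigma> (k + 1)"
  shows "inv_number n (\<sigma> \<circ> transpose k (k + 1)) = inv_number n \<sigma> + 1"
proof -
  let ?s = "transpose k (k + 1)"
  let ?I = "\<lambda>\<sigma>. {(i, j). 1 \<le> i \<and> i < j \<and> j \<le> n \<and> \<sigma> j < (\<sigma> i :: nat)}"
  let ?f = "\<lambda>(i, j). (?s i, ?s j)"
  have fin: "finite (?I \<tau>)" for \<tau>
    by (rule finite_subset[of _ "{1..n} \<times> {1..n}"]) auto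
  have mem: "?f p \<in> ?I (\<sigma> \<circ> ?s) - {(k, k + 1)}" if "p \<in> ?I \<sigma>" for p
    using that assms by (auto simp: transpose_def split: if_splits)
  have mem': "?f p \<in> ?I \<sigma>" if "p \<in> ?I (\<sigma> \<circ> ?s) - {(k, k + 1)}" for p
    using that assms by (auto simp: transpose_def split: if_splits)
  have "bij_betw ?f (?I \<sigma>) (?I (\<sigma> \<circ> ?s) - {(k, k + 1)})"
    by (rule bij_betw_byWitness[where f' = ?f]) (use mem mem' in \<open>simp_all add: image_subset_iff case_prod_beta\<close>)
  then have "card (?I \<sigma>) = card (?I (\<sigma> \<circ> ?s) - {(k, k + 1)})"
    by (rule bij_betw_same_card)
  moreover have "(k, k + 1) \<in> ?I (\<sigma> \<circ> ?s)"
    using assms by (simp add: transpose_def)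
  ultimately have "card (?I (\<sigma> \<circ> ?s)) = card (?I \<sigma>) + 1"
    using card_Suc_Diff1[OF fin[of "\<sigma> \<circ> ?s"], of "(k, k + 1)"] by simp
  then show ?thesis
    unfolding inv_number_def .
qed

lemma inv_number_descent:
  assumes "1 \<le> k" "k + 1 \<le> n" "\<sigma> (k + 1) < \<sigma> k"
  shows "inv_number n \<sigma> = inv_number n (\<sigma> \<circ> transpose k (k + 1)) + 1"
  using inv_number_ascent[of k n "\<sigma> \<circ> transpose k (k + 1)"] assms
  by (simp add: comp_assoc)

lemma inv_number_snoc:
  assumes "k \<in> {1..n - 1}"
  shows "inv_number n (word_perm (w @ [k])) =
    (if word_perm w k < word_perm w (k + 1) then inv_number n (word_perm w) + 1
     else inv_number n (word_perm w) - 1)"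
proof -
  have "word_perm w k \<noteq> word_perm w (k + 1)"
    using injD[OF word_perm_inj, of w k "k + 1"] by auto
  then show ?thesis
    using assms inv_number_ascent[of k n "word_perm w"] inv_number_descent[of k n "word_perm w"]
    by (auto simp: word_perm_snoc)
qed

lemma inv_number_le_length:
  assumes "set w \<subseteq> {1..n - 1}"
  shows "inv_number n (word_perm w) \<le> length w"
  using assms
proof (induction w rule: rev_induct)
  case (snoc k w)
  then show ?case by (auto simp: inv_number_snoc)
qed simp

text \<open>
  Removing a descent lowers the number of inversions by one, so a reduced word can be built from its
  last letter on. A permutation without descents satisfies \<open>i \<le> \<sigma> i\<close> everywhere and is the identity.
\<close>

lemma reduced_word_exists:
  assumes "\<sigma> permutes {1..n}"
  shows "\<exists>w. w \<in> reduced_words n \<sigma>"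
  using assms
proof (induction "inv_number n \<sigma>" arbitrary: \<sigma> rule: less_induct)
  case less
  show ?case
  proof (cases "\<exists>k. 1 \<le> k \<and> k + 1 \<le> n \<and> \<sigma> (k + 1) < \<sigma> k")
    case True
    then obtain k where k: "1 \<le> k" "k + 1 \<le> n" "\<sigma> (k + 1) < \<sigma> k" by blast
    let ?\<tau> = "\<sigma> \<circ> transpose k (k + 1)"
    have "?\<tau> permutes {1..n}"
      using less.prems k by (intro permutes_compose permutes_swap_id) auto
    moreover have inv: "inv_number n \<sigma> = inv_number n ?\<tau> + 1"
      using k by (rule inv_number_descent)
    ultimately obtain w where "w \<in> reduced_words n ?\<tau>"
      using less.hyps[of ?\<tau>] by auto
    then have "w @ [k] \<in> reduced_words n \<sigma>"
      using inv k by (auto simp: reduced_words_def word_perm_snoc comp_assoc)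
    then show ?thesis ..
  next
    case False
    have step: "\<sigma> k < \<sigma> (k + 1)" if "1 \<le> k" "k + 1 \<le> n" for k
    proof -
      have "\<sigma> k \<noteq> \<sigma> (k + 1)"
        using permutes_inj[OF less.prems] by (metis injD n_not_Suc_n Suc_eq_plus1)
      then show ?thesis using False that by (meson linorder_neqE_nat)
    qed
    have less: "\<sigma> i < \<sigma> j" if "1 \<le> i" "j \<le> n" "i < j" for i j
      using \<open>i < j\<close> \<open>j \<le> n\<close>
    proof (induction j)
      case (Suc j)
      then show ?case using step[of j] \<open>1 \<le> i\<close> by (cases "i = j") auto
    qed simp
    have "{(i, j). 1 \<le> i \<and> i < j \<and> j \<le> n \<and> \<sigma> j < \<sigma> i} = {}"
      using less by fastforce
    then have "inv_number n \<sigma> = 0"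
      unfolding inv_number_def by (simp only: card.empty)
    moreover have "i \<le> \<sigma> i" if "1 \<le> i" "i \<le> n" for i
      using that
    proof (induction i rule: dec_induct)
      case base
      then show ?case using permutes_in_image[OF less.prems, of 1] by simp
    next
      case (step i)
      then show ?case using less[of i "Suc i"] by simp
    qed
    then have "\<sigma> = id"
      by (intro permutes_natset_ge[OF less.prems]) simp
    ultimately have "[] \<in> reduced_words n \<sigma>"
      by (simp add: reduced_words_def)
    then show ?thesis ..
  qed
qed

section \<open>Reduced words\<close>

text \<open>
  Words that are reduced for the permutation that they define. The bound \<open>n\<close> is a parameter because
  the number of inversions is counted on \<open>1, \<dots>, n\<close>.
\<close>

definition reduced :: "nat \<Rightarrow> nat list \<Rightarrow> bool" where
  "reduced n w \<longleftrightarrow> w \<in> reduced_words n (word_perm w)"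

lemma reduced_Nil [simp]: "reduced n []"
  by (simp add: reduced_def reduced_words_def)

lemma reduced_letters: "reduced n w \<Longrightarrow> set w \<subseteq> {1..n - 1}"
  by (simp add: reduced_def reduced_words_def)

lemma reduced_minimal:
  assumes "reduced n w" "word_perm v = word_perm w" "set v \<subseteq> {1..n - 1}"
  shows "length w \<le> length v"
  using assms inv_number_le_length[of v n] by (simp add: reduced_def reduced_words_def)

text \<open>
  Commutations and braid relations keep the permutation, the length and the set of letters; this is how
  reducedness is transported along insertion.
\<close>

lemma reduced_cong:
  assumes "word_perm v = word_perm w" "length v = length w" "set v = set w"
  shows "reduced n v \<longleftrightarrow> reduced n w"
  using assms by (simp add: reduced_def reduced_words_def)

text \<open>
  If a factor were not reduced, then replacing it by a reduced word of its permutation would shorten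
  the whole word.
\<close>

lemma reduced_factor:
  assumes "reduced n (u @ v @ x)"
  shows "reduced n v"
proof -
  have sub: "set (u @ v @ x) \<subseteq> {1..n - 1}"
    using assms by (rule reduced_letters)
  then obtain v' where v': "v' \<in> reduced_words n (word_perm v)"
    using reduced_word_exists[OF word_perm_permutes, of v n] by auto
  then have "length (u @ v @ x) \<le> length (u @ v' @ x)"
    using sub by (intro reduced_minimal[OF assms])
      (auto simp: word_perm_append reduced_words_def)
  then show ?thesis
    using v' sub inv_number_le_length[of v n] by (auto simp: reduced_def reduced_words_def)
qed

lemma reduced_prefix: "reduced n (u @ v) \<Longrightarrow> reduced n u"
  using reduced_factor[of n "[]" u v] by simp

lemma reduced_suffix: "reduced n (u @ v) \<Longrightarrow> reduced n v"
  using reduced_factor[of n u v "[]"] by simp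

text \<open>
  In particular the last letter of a reduced word is a descent of its permutation; the argument that
  132-avoidance forces frozen tableaux rests on this.
\<close>

lemma reduced_snoc:
  assumes "k \<in> {1..n - 1}"
  shows "reduced n (w @ [k]) \<longleftrightarrow> reduced n w \<and> word_perm w k < word_perm w (k + 1)"
proof
  assume *: "reduced n (w @ [k])"
  then have "inv_number n (word_perm (w @ [k])) = length w + 1"
    by (simp add: reduced_def reduced_words_def)
  moreover have "inv_number n (word_perm w) \<le> length w"
    using reduced_letters[OF *] by (intro inv_number_le_length) auto
  ultimately show "reduced n w \<and> word_perm w k < word_perm w (k + 1)"
    using reduced_prefix[OF *] assms by (auto simp: inv_number_snoc split: if_splits)
next
  assume "reduced n w \<and> word_perm w k < word_perm w (k + 1)"
  then show "reduced n (w @ [k])"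
    using assms by (simp add: reduced_def reduced_words_def inv_number_snoc)
qed

lemma reduced_square_free:
  assumes "word_perm w = word_perm (u @ x # x # v)" "set (u @ x # x # v) = set w"
    "length w = length (u @ x # x # v)"
  shows "\<not> reduced n w"
proof
  assume *: "reduced n w"
  have "length w \<le> length (u @ v)"
    using assms reduced_letters[OF *] by (intro reduced_minimal[OF *]) (auto simp: word_perm_cancel)
  then show False using assms by simp
qed

section \<open>Bumping an entry out of a row\<close>

text \<open>
  The effect of one row on an insertion that does not end there: \<open>x\<close> enters the row \<open>R\<close>, the row
  becomes \<open>R'\<close>, and \<open>y\<close> is passed on to the next row. It is a relation on all four data, given by
  splittings of the rows, so that it can be read forwards and backwards.
\<close>

inductive bump :: "nat \<Rightarrow> nat list \<Rightarrow> nat \<Rightarrow> nat list \<Rightarrow> bool" where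
  replace: "sorted_wrt (<) (A @ y # B) \<Longrightarrow> \<forall>a \<in> set A. a < x \<Longrightarrow> x < y \<Longrightarrow>
    bump x (A @ y # B) y (A @ x # B)"
| keep: "sorted_wrt (<) (A @ x # (x + 1) # B) \<Longrightarrow>
    bump x (A @ x # (x + 1) # B) (x + 1) (A @ x # (x + 1) # B)"

lemma sorted_wrt_less_split:
  fixes R :: "nat list"
  assumes "sorted_wrt (<) R"
  shows "R = filter (\<lambda>z. z < x) R @ filter (\<lambda>z. x \<le> z) R"
  using assms
proof (induction R)
  case (Cons a R)
  show ?case
  proof (cases "a < x")
    case True
    then show ?thesis using Cons by simp
  next
    case False
    then have "filter (\<lambda>z. z < x) R = []" "filter (\<lambda>z. x \<le> z) R = R"
      using Cons.prems by (auto simp: filter_empty_conv filter_id_conv)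
    then show ?thesis using False by simp
  qed
qed simp

lemma sorted_wrt_less_splitE:
  fixes R :: "nat list"
  assumes "sorted_wrt (<) R"
  obtains A C where "R = A @ C" "\<forall>a \<in> set A. a < x" "\<forall>c \<in> set C. x \<le> c"
proof
  show "R = filter (\<lambda>z. z < x) R @ filter (\<lambda>z. x \<le> z) R"
    using assms by (rule sorted_wrt_less_split)
qed auto

lemma bump_eg_insert:
  assumes "bump x R y R'"
  shows "eg_insert x (R # Rs) = R' # eg_insert y Rs"
  using assms
proof cases
  case (replace A B)
  have "Min {z \<in> set R. x < z} = y"
    unfolding replace using replace(3-5) by (intro Min_eqI) (auto simp: sorted_wrt_append)
  moreover have "map (\<lambda>z. if z = y then x else z) R = R'"
    using replace by (auto simp: sorted_wrt_append intro!: map_idI)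
  moreover have "x \<notin> set R"
    using replace by (auto simp: sorted_wrt_append)
  moreover have "\<not> (\<forall>z \<in> set R. z < x)"
    using replace by auto
  ultimately show ?thesis
    by (auto simp: Let_def)
next
  case (keep A B)
  then show ?thesis by auto
qed

text \<open>
  The special rule of the insertion keeps a row that contains \<open>x\<close> and passes on \<open>x + 1\<close>. The point is
  that this row must then contain \<open>x + 1\<close> as well: otherwise the appended \<open>x\<close> commutes with all larger
  entries and meets the \<open>x\<close> of the row, and a square is not reduced.
\<close>

lemma bump_exists:
  assumes "reduced n (R @ [x])" "sorted_wrt (<) R" "\<not> (\<forall>z \<in> set R. z < x)"
  shows "\<exists>y R'. bump x R y R'"
proof -
  obtain A C where R: "R = A @ C" "\<forall>a \<in> set A. a < x" "\<forall>c \<in> set C. x \<le> c"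
    using sorted_wrt_less_splitE[OF assms(2)] .
  then obtain c B where C: "C = c # B"
    using assms(3) by (cases C) auto
  show ?thesis
  proof (cases "c = x")
    case False
    then show ?thesis
      using bump.replace[of A c B x] assms(2) R C by auto
  next
    case True
    have B: "\<forall>b \<in> set B. x < b"
      using assms(2) R C True by (auto simp: sorted_wrt_append)
    have "\<exists>B'. B = (x + 1) # B'"
    proof (rule ccontr)
      assume *: "\<not> ?thesis"
      have "\<forall>b \<in> set B. x + 1 < b"
      proof (cases B)
        case (Cons b B')
        then have "x + 1 < b" using B * by (auto simp: less_Suc_eq)
        then show ?thesis using assms(2) R C Cons by (auto simp: sorted_wrt_append)
      qed simp
      then have "word_perm (B @ [x]) = word_perm (x # B)"
        by (intro word_perm_commute) auto
      \<comment> \<open>The appended \<open>x\<close> passes \<open>B\<close> and comes to stand next to the \<open>x\<close> of the row.\<close>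
      then have "word_perm ((A @ [x]) @ B @ [x]) = word_perm ((A @ [x]) @ x # B)"
        by (simp only: word_perm_append)
      then have "word_perm (R @ [x]) = word_perm (A @ x # x # B)"
        using R C True by simp
      then have "\<not> reduced n (R @ [x])"
        by (rule reduced_square_free) (use R C True in auto)
      then show False using assms(1) by simp
    qed
    then show ?thesis
      using bump.keep[of A x] assms(2) R C True by auto
  qed
qed

text \<open>
  This mirrors the forward direction: the entry to be extracted is the largest one below \<open>y\<close>. If \<open>y\<close>
  itself lies in the row, then that entry is \<open>y - 1\<close>, since otherwise the letter \<open>y\<close> in front commutes
  with all smaller entries and meets the \<open>y\<close> of the row.
\<close>

lemma bump_exists_reverse:
  assumes "reduced n (y # R')" "sorted_wrt (<) R'" "\<exists>z \<in> set R'. z < y"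
  shows "\<exists>x R. bump x R y R'"
proof -
  obtain A0 C where R': "R' = A0 @ C" "\<forall>a \<in> set A0. a < y" "\<forall>c \<in> set C. y \<le> c"
    using sorted_wrt_less_splitE[OF assms(2)] .
  then obtain A x where A0: "A0 = A @ [x]"
    using assms(3) by (cases A0 rule: rev_cases) auto
  have A: "\<forall>a \<in> set A. a < x" and x: "x < y"
    using assms(2) R' A0 by (auto simp: sorted_wrt_append)
  show ?thesis
  proof (cases "y \<in> set C")
    case False
    then have "\<forall>c \<in> set C. y < c"
      using R'(3) by (metis le_neq_implies_less)
    then have "bump x (A @ y # C) y (A @ x # C)"
      using assms(2) R' A0 A x by (intro bump.replace) (auto simp: sorted_wrt_append)
    then show ?thesis
      using R' A0 by auto
  next
    case True
    then obtain B where C: "C = y # B"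
      using assms(2) R' by (cases C) (auto simp: sorted_wrt_append)
    have "y = x + 1"
    proof (rule ccontr)
      assume "y \<noteq> x + 1"
      then have "\<forall>a \<in> set A0. a + 1 < y"
        using A x A0 by auto
      then have "word_perm (A0 @ [y]) = word_perm (y # A0)"
        by (intro word_perm_commute) auto
      then have "word_perm ([y] @ (A0 @ [y]) @ B) = word_perm ([y] @ (y # A0) @ B)"
        by (simp only: word_perm_append)
      then have "word_perm (y # R') = word_perm ([] @ y # y # A0 @ B)"
        by (simp add: R' C)
      then have "\<not> reduced n (y # R')"
        by (rule reduced_square_free) (auto simp: R' C)
      then show False using assms(1) by simp
    qed
    then show ?thesis
      using bump.keep[of A x B] assms(2) R' A0 C by auto
  qed
qed

text \<open>
  Appending \<open>x\<close> to the old row and putting \<open>y\<close> in front of the new one are Coxeter--Knuth equivalent: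
  \<open>x\<close> moves left past the larger entries, a braid relation is applied if the row is kept, and \<open>y\<close>
  moves left past the smaller entries.
\<close>

lemma bump_word_perm:
  assumes "bump x R y R'"
  shows "word_perm (R @ [x]) = word_perm (y # R')"
  using assms
proof cases
  case (replace A B)
  have "word_perm (B @ [x]) = word_perm (x # B)" "word_perm (A @ [y]) = word_perm (y # A)"
    using replace by (force simp: sorted_wrt_append intro!: word_perm_commute)+
  have "word_perm (R @ [x]) = word_perm (A @ [y]) \<circ> word_perm (B @ [x])"
    unfolding replace by (simp flip: word_perm_append)
  also have "\<dots> = word_perm (y # A) \<circ> word_perm (x # B)"
    by (simp only: \<open>word_perm (B @ [x]) = _\<close> \<open>word_perm (A @ [y]) = _\<close>)
  also have "\<dots> = word_perm (y # R')"
    unfolding replace by (simp flip: word_perm_append)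
  finally show ?thesis .
next
  case (keep A B)
  have "word_perm (B @ [x]) = word_perm (x # B)" "word_perm (A @ [x + 1]) = word_perm ((x + 1) # A)"
    using keep by (force simp: sorted_wrt_append intro!: word_perm_commute)+
  have "word_perm (R @ [x]) = word_perm (A @ [x, x + 1]) \<circ> word_perm (B @ [x])"
    unfolding keep by (simp flip: word_perm_append)
  also have "\<dots> = word_perm A \<circ> word_perm [x, x + 1, x] \<circ> word_perm B"
    by (simp only: \<open>word_perm (B @ [x]) = _\<close>) (simp flip: word_perm_append)
  also have "\<dots> = word_perm (A @ [x + 1]) \<circ> word_perm ([x, x + 1] @ B)"
    by (simp only: word_perm_braid) (simp flip: word_perm_append)
  also have "\<dots> = word_perm (y # R')"
    by (simp only: \<open>word_perm (A @ [x + 1]) = _\<close>) (simp add: keep flip: word_perm_append)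
  finally show ?thesis .
qed

lemma bump_length: "bump x R y R' \<Longrightarrow> length R' = length R"
  by (auto elim: bump.cases)

lemma bump_sorted:
  assumes "bump x R y R'"
  shows "sorted_wrt (<) R" "sorted_wrt (<) R'"
  using assms by (cases; fastforce simp: sorted_wrt_append)+

lemma bump_mem:
  assumes "bump x R y R'"
  shows "x < y" "y \<in> set R" "x \<in> set R'"
  using assms by (cases; simp)+

lemma bump_set:
  assumes "bump x R y R'"
  shows "set R = (if y \<in> set R' then set R' else insert y (set R') - {x})"
  using assms by cases (auto simp: sorted_wrt_append)

lemma bump_insert_set:
  assumes "bump x R y R'"
  shows "insert y (set R') = insert x (set R)"
  using assms by cases auto

lemma bump_below:
  assumes "bump x R y R'"
  shows "\<exists>A. filter (\<lambda>z. z < y) R' = A @ [x]"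
  using assms by cases (fastforce simp: sorted_wrt_append filter_empty_conv)+

text \<open>
  The largest entry of the new row below \<open>y\<close> is \<open>x\<close>, and whether the new row contains \<open>y\<close> tells which
  of the two rules was used.
\<close>

lemma bump_inj:
  assumes "bump x R y R'" "bump x2 R2 y R'"
  shows "x = x2 \<and> R = R2"
proof -
  have x: "x = x2"
    using bump_below[OF assms(1)] bump_below[OF assms(2)] by auto
  have "set R = set R2"
    using bump_set[OF assms(1)] bump_set[OF assms(2)] x by simp
  then show ?thesis
    using x bump_sorted(1)[OF assms(1)] bump_sorted(1)[OF assms(2)] strict_sorted_equal by blast
qed

section \<open>Strictness of columns under bumping\<close>

definition count_less :: "nat \<Rightarrow> nat list \<Rightarrow> nat" where
  "count_less t R = length (filter (\<lambda>z. z < t) R)"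

lemma count_less_append [simp]: "count_less t (A @ B) = count_less t A + count_less t B"
  by (simp add: count_less_def)

lemma count_less_Nil [simp]: "count_less t [] = 0"
  by (simp add: count_less_def)

lemma count_less_Cons [simp]: "count_less t (a # B) = (if a < t then 1 else 0) + count_less t B"
  by (simp add: count_less_def)

lemma count_less_all: "\<forall>a \<in> set A. a < t \<Longrightarrow> count_less t A = length A"
  by (simp add: count_less_def)

lemma count_less_none: "\<forall>a \<in> set A. t \<le> a \<Longrightarrow> count_less t A = 0"
  by (simp add: count_less_def filter_empty_conv linorder_not_less)

lemma count_less_le_length: "count_less t A \<le> length A"
  by (simp add: count_less_def)

lemma count_less_mono: "s \<le> t \<Longrightarrow> count_less s A \<le> count_less t A"
  by (induction A) auto

text \<open>
  For strictly increasing rows, with \<open>S\<close> placed below \<open>R\<close>, this says that \<open>S\<close> is at most as long as \<open>R\<close> and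
  exceeds it in every column: if \<open>t\<close> is the \<open>j\<close>-th entry of \<open>S\<close>, then at least \<open>j\<close> entries of \<open>R\<close> are
  smaller than \<open>t\<close>. In the counting form no positions have to be tracked when entries are bumped.
\<close>

definition column_strict :: "nat list \<Rightarrow> nat list \<Rightarrow> bool" where
  "column_strict R S \<longleftrightarrow> (\<forall>t. count_less (t + 1) S \<le> count_less t R)"

lemma column_strictD:
  assumes "column_strict R S" "0 < t"
  shows "count_less t S \<le> count_less (t - 1) R"
  using assms(1)[unfolded column_strict_def, rule_format, of "t - 1"] assms(2) by simp

lemma column_strict_length:
  assumes "column_strict R S"
  shows "length S \<le> length R"
proof -
  \<comment> \<open>Every entry of \<open>S\<close> is at most this threshold, so that the whole row is counted.\<close>
  define t where "t = Max (insert 0 (set S))"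
  have "count_less (t + 1) S = length S"
    by (rule count_less_all) (auto simp: t_def less_Suc_eq_le)
  then show ?thesis
    using assms count_less_le_length[of t R] by (metis column_strict_def le_trans)
qed

lemma column_strict_mem:
  assumes "column_strict R S" "y \<in> set S"
  shows "\<exists>z \<in> set R. z < y"
proof -
  have "count_less (y + 1) S \<noteq> 0"
    using assms(2) by (auto simp: count_less_def filter_empty_conv)
  then have "count_less y R \<noteq> 0"
    using assms(1) by (metis column_strict_def le_zero_eq)
  then show ?thesis
    by (auto simp: count_less_def filter_empty_conv)
qed

text \<open>
  A bump replaces \<open>y\<close> by the smaller \<open>x\<close> or changes nothing, so the count never falls and can change
  only at thresholds \<open>t\<close> with \<open>x < t \<le> y\<close>. The other four estimates cover both rules at once: those
  about an inserted entry are used for the row that receives \<open>x\<close>, those about an ejected entry for the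
  row that passes on \<open>y\<close>, and the reverse ones serve to undo an insertion.
\<close>

lemma count_less_bump:
  assumes "bump x R y R'"
  shows count_less_bump_le: "count_less t R \<le> count_less t R'"
    and count_less_bump_eq: "t \<le> x \<or> y < t \<Longrightarrow> count_less t R' = count_less t R"
    and count_less_bump_inserted: "x < t \<Longrightarrow> t \<le> y \<Longrightarrow> count_less t R' \<le> count_less x R + 1"
    and count_less_bump_ejected: "count_less (y - 1) R + 1 \<le> count_less y R'"
    and count_less_bump_inserted_reverse: "t \<le> x + 1 \<Longrightarrow> count_less t R + 1 \<le> count_less (x + 2) R'"
    and count_less_bump_ejected_reverse: "x < t \<Longrightarrow> count_less (y + 1) R' \<le> count_less t R + 1"
proof -
  have "\<exists>A B. (\<forall>a \<in> set A. a < x) \<and> (\<forall>b \<in> set B. y < b) \<and> x < y \<and>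
      (R = A @ y # B \<and> R' = A @ x # B \<or> y = x + 1 \<and> R = A @ x # y # B \<and> R' = R)"
    using assms
  proof cases
    case (replace A B)
    then show ?thesis
      by (intro exI[of _ A] exI[of _ B]) (simp add: sorted_wrt_append)
  next
    case (keep A B)
    then show ?thesis
      by (intro exI[of _ A] exI[of _ B]) (simp add: sorted_wrt_append)
  qed
  then obtain A B where A: "\<forall>a \<in> set A. a < x" and B: "\<forall>b \<in> set B. y < b" and "x < y"
    and RR: "R = A @ y # B \<and> R' = A @ x # B \<or> y = x + 1 \<and> R = A @ x # y # B \<and> R' = R"
    by metis
  have A': "count_less s A = length A" if "x \<le> s" for s
    using that A by (intro count_less_all) auto
  have B': "count_less s B = 0" if "s \<le> y + 1" for s
    using that B by (intro count_less_none) auto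
  show "count_less t R \<le> count_less t R'"
    using RR \<open>x < y\<close> by auto
  show "count_less t R' = count_less t R" if "t \<le> x \<or> y < t"
    using RR \<open>x < y\<close> that by auto
  show "count_less t R' \<le> count_less x R + 1" if "x < t" "t \<le> y"
    using RR \<open>x < y\<close> that by (auto simp: A' B')
  show "count_less (y - 1) R + 1 \<le> count_less y R'"
    using RR \<open>x < y\<close> by (auto simp: A' B')
  show "count_less t R + 1 \<le> count_less (x + 2) R'" if "t \<le> x + 1"
    using RR \<open>x < y\<close> that count_less_le_length[of t A] by (auto simp: A' B')
  show "count_less (y + 1) R' \<le> count_less t R + 1" if "x < t"
    using RR \<open>x < y\<close> that by (auto simp: A' B')
qed

text \<open>
  The count in the lower row can grow only at thresholds above \<open>y\<close> and up to \<open>z\<close>, and there it is at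
  most one more than the old count below \<open>y\<close>. The upper row makes up for this: it contains \<open>x < y\<close>,
  which was not among its entries below \<open>y - 1\<close> before the bump.
\<close>

lemma column_strict_bump_bump:
  assumes "column_strict R S" "bump x R y R'" "bump y S z S'"
  shows "column_strict R' S'"
  unfolding column_strict_def
proof
  fix t
  show "count_less (t + 1) S' \<le> count_less t R'"
  proof (cases "y \<le> t \<and> t < z")
    case True
    have "y \<noteq> 0" using bump_mem(1)[OF assms(2)] by simp
    have "count_less (t + 1) S' \<le> count_less y S + 1"
      using count_less_bump_inserted[OF assms(3)] True by simp
    also have "\<dots> \<le> count_less (y - 1) R + 1"
      using column_strictD[OF assms(1), of y] \<open>y \<noteq> 0\<close> by simp
    also have "\<dots> \<le> count_less y R'"
      by (rule count_less_bump_ejected[OF assms(2)])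
    also have "\<dots> \<le> count_less t R'"
      using True by (intro count_less_mono) simp
    finally show ?thesis .
  next
    case False
    then have "count_less (t + 1) S' = count_less (t + 1) S"
      by (intro count_less_bump_eq[OF assms(3)]) auto
    also have "\<dots> \<le> count_less t R"
      using assms(1) by (simp add: column_strict_def)
    also have "\<dots> \<le> count_less t R'"
      by (rule count_less_bump_le[OF assms(2)])
    finally show ?thesis .
  qed
qed

text \<open>
  The same estimate as for a second bump, with no upper limit for the threshold.
\<close>

lemma column_strict_bump_append:
  assumes "column_strict R S" "bump x R y R'" "\<forall>z \<in> set S. z < y"
  shows "column_strict R' (S @ [y])"
  unfolding column_strict_def
proof
  fix t
  show "count_less (t + 1) (S @ [y]) \<le> count_less t R'"
  proof (cases "y \<le> t")
    case True
    have "y \<noteq> 0" using bump_mem(1)[OF assms(2)] by simp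
    have "count_less (t + 1) (S @ [y]) \<le> length S + 1"
      using count_less_le_length[of "t + 1" "S @ [y]"] by simp
    also have "\<dots> = count_less y S + 1"
      using assms(3) by (simp add: count_less_all)
    also have "\<dots> \<le> count_less (y - 1) R + 1"
      using column_strictD[OF assms(1), of y] \<open>y \<noteq> 0\<close> by simp
    also have "\<dots> \<le> count_less y R'"
      by (rule count_less_bump_ejected[OF assms(2)])
    also have "\<dots> \<le> count_less t R'"
      using True by (intro count_less_mono) simp
    finally show ?thesis .
  next
    case False
    then have "count_less (t + 1) (S @ [y]) = count_less (t + 1) S"
      by simp
    also have "\<dots> \<le> count_less t R"
      using assms(1) by (simp add: column_strict_def)
    also have "\<dots> \<le> count_less t R'"
      by (rule count_less_bump_le[OF assms(2)])
    finally show ?thesis .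
  qed
qed

text \<open>reverse direction, common part\<close>
text \<open>
  The critical thresholds are now those where extracting \<open>x\<close> lowers the count in the upper row. There
  the presence of \<open>y\<close> in \<open>S'\<close> gives the one entry to spare that the second assumption on \<open>S\<close> asks for,
  whether \<open>y\<close> had been appended to \<open>S\<close> or had been bumped into it.
\<close>

lemma column_strict_unbump:
  assumes "column_strict R' S'" "bump x R y R'"
    and S: "\<And>t. count_less t S \<le> count_less t S'"
      "\<And>t. t \<le> y + 1 \<Longrightarrow> count_less t S + 1 \<le> count_less (y + 2) S'"
  shows "column_strict R S"
  unfolding column_strict_def
proof
  fix t
  show "count_less (t + 1) S \<le> count_less t R"
  proof (cases "x < t \<and> t \<le> y")
    case True
    then have "count_less (t + 1) S + 1 \<le> count_less (y + 2) S'"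
      by (intro S(2)) simp
    also have "\<dots> \<le> count_less (y + 1) R'"
      using assms(1)[unfolded column_strict_def, rule_format, of "y + 1"] by simp
    also have "\<dots> \<le> count_less t R + 1"
      using count_less_bump_ejected_reverse[OF assms(2)] True by simp
    finally show ?thesis by simp
  next
    case False
    have "count_less (t + 1) S \<le> count_less (t + 1) S'"
      by (rule S(1))
    also have "\<dots> \<le> count_less t R'"
      using assms(1) by (simp add: column_strict_def)
    also have "\<dots> = count_less t R"
      using False by (intro count_less_bump_eq[OF assms(2)]) auto
    finally show ?thesis .
  qed
qed

lemma column_strict_unbump_bump:
  assumes "column_strict R' S'" "bump x R y R'" "bump y S z S'"
  shows "column_strict R S"
  by (rule column_strict_unbump[OF assms(1,2)])
    (use count_less_bump_le[OF assms(3)] count_less_bump_inserted_reverse[OF assms(3)] in auto)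

lemma column_strict_unbump_append:
  assumes "column_strict R' (S @ [y])" "bump x R y R'" "\<forall>z \<in> set S. z < y"
  shows "column_strict R S"
proof (rule column_strict_unbump[OF assms(1,2)])
  have "\<forall>z \<in> set S. z < y + 2" using assms(3) by auto
  then show "count_less t S + 1 \<le> count_less (y + 2) (S @ [y])" for t
    using count_less_le_length[of t S] by (simp add: count_less_all)
qed simp

section \<open>Insertion into tableaux of reduced words\<close>

definition reading_word :: "nat list list \<Rightarrow> nat list" where
  "reading_word P = concat (rev P)"

lemma reading_word_Nil [simp]: "reading_word [] = []"
  by (simp add: reading_word_def)

lemma reading_word_Cons [simp]: "reading_word (R # P) = reading_word P @ R"
  by (simp add: reading_word_def)

text \<open>
  The tableaux that occur as insertion tableaux of reduced words. Reducedness of the reading word ensures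
  that a row kept by the special rule contains both \<open>x\<close> and \<open>x + 1\<close>, so that this rule can be reversed.
\<close>

definition eg_tableau :: "nat \<Rightarrow> nat list list \<Rightarrow> bool" where
  "eg_tableau n P \<longleftrightarrow> reduced n (reading_word P) \<and>
     (\<forall>R \<in> set P. R \<noteq> [] \<and> sorted_wrt (<) R) \<and> successively column_strict P"

lemma column_strict_Nil: "column_strict R []"
  by (simp add: column_strict_def)

lemma eg_tableau_Nil: "eg_tableau n []"
  by (simp add: eg_tableau_def)

lemma eg_tableau_Cons:
  "eg_tableau n (R # P) \<longleftrightarrow> eg_tableau n P \<and> reduced n (reading_word P @ R) \<and> R \<noteq> [] \<and>
     sorted_wrt (<) R \<and> (P = [] \<or> column_strict R (hd P))"
  unfolding eg_tableau_def by (auto simp: successively_Cons dest: reduced_prefix)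

lemma eg_insert_append: "\<forall>z \<in> set R. z < x \<Longrightarrow> eg_insert x (R # P) = (R @ [x]) # P"
  by simp

declare eg_insert.simps(2) [simp del]

lemma eg_insert_neq_Nil: "eg_insert x P \<noteq> []"
  by (cases P) (auto simp: eg_insert.simps(2) Let_def)

lemma reduced_bump:
  assumes "bump x R y R'"
  shows "reduced n (u @ y # R') \<longleftrightarrow> reduced n (u @ R @ [x])"
proof (rule reduced_cong)
  show "word_perm (u @ y # R') = word_perm (u @ R @ [x])"
    using bump_word_perm[OF assms] by (simp only: word_perm_append)
  show "set (u @ y # R') = set (u @ R @ [x])"
    using bump_insert_set[OF assms] by simp
qed (simp add: bump_length[OF assms])

text \<open>rule\<close>
text \<open>
  Induction along the rows that an insertion passes through. The last rule supplies what the bump in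
  the first row guarantees for the insertion of \<open>y\<close> into the rows below.
\<close>

lemma eg_insert_induct [consumes 2, case_names Nil append bump]:
  assumes "eg_tableau n P" "reduced n (reading_word P @ [x])"
    and "\<And>x. reduced n [x] \<Longrightarrow> Q x []"
    and "\<And>x R P. eg_tableau n (R # P) \<Longrightarrow> reduced n (reading_word P @ R @ [x]) \<Longrightarrow>
      \<forall>z \<in> set R. z < x \<Longrightarrow> Q x (R # P)"
    and "\<And>x R y R' P. eg_tableau n (R # P) \<Longrightarrow> reduced n (reading_word P @ R @ [x]) \<Longrightarrow>
      bump x R y R' \<Longrightarrow> reduced n (reading_word P @ y # R') \<Longrightarrow> reduced n (reading_word P @ [y]) \<Longrightarrow>
      Q y P \<Longrightarrow> Q x (R # P)"
  shows "Q x P"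
  using assms(1,2)
proof (induction P arbitrary: x)
  case Nil
  then show ?case by (intro assms(3)) simp
next
  case (Cons R P)
  then have RP: "eg_tableau n (R # P)" and red: "reduced n (reading_word P @ R @ [x])"
    by simp_all
  show ?case
  proof (cases "\<forall>z \<in> set R. z < x")
    case True
    with RP red show ?thesis by (rule assms(4))
  next
    case False
    obtain y R' where bump: "bump x R y R'"
      using bump_exists[of n R x] reduced_suffix[OF red] False RP by (auto simp: eg_tableau_Cons)
    have red': "reduced n (reading_word P @ y # R')"
      using red reduced_bump[OF bump] by blast
    then have "reduced n (reading_word P @ [y])"
      using reduced_prefix[of n "reading_word P @ [y]" R'] by simp
    moreover from this have "Q y P"
      using Cons.IH[of y] RP by (simp add: eg_tableau_Cons)
    ultimately show ?thesis
      using assms(5) RP red bump red' by blast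
  qed
qed

text \<open>
  The next row either receives \<open>y\<close> at its end or bumps it in; both cases were treated above.
\<close>

lemma column_strict_eg_insert:
  assumes "eg_tableau n (R # P)" "bump x R y R'" "reduced n (reading_word P @ [y])"
  shows "column_strict R' (hd (eg_insert y P))"
proof (cases P)
  case Nil
  then show ?thesis
    using column_strict_bump_append[OF column_strict_Nil assms(2)] by simp
next
  case (Cons S P')
  then have RS: "column_strict R S" and S: "sorted_wrt (<) S"
    using assms(1) by (auto simp: eg_tableau_Cons)
  show ?thesis
  proof (cases "\<forall>z \<in> set S. z < y")
    case True
    then show ?thesis
      using column_strict_bump_append[OF RS assms(2)] by (simp add: Cons eg_insert_append)
  next
    case False
    moreover have "reduced n (S @ [y])"
      using assms(3) reduced_suffix[of n "reading_word P'" "S @ [y]"] by (simp add: Cons)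
    ultimately obtain z S' where "bump y S z S'"
      using bump_exists[of n S y] S by metis
    then show ?thesis
      using column_strict_bump_bump[OF RS assms(2)] by (simp add: Cons bump_eg_insert)
  qed
qed

lemma eg_insert_reading_word:
  assumes "eg_tableau n P" "reduced n (reading_word P @ [x])"
  shows word_perm_eg_insert: "word_perm (reading_word (eg_insert x P)) = word_perm (reading_word P @ [x])"
    and length_eg_insert: "length (reading_word (eg_insert x P)) = length (reading_word P) + 1"
    and set_eg_insert: "set (reading_word (eg_insert x P)) = insert x (set (reading_word P))"
proof -
  have "word_perm (reading_word (eg_insert x P)) = word_perm (reading_word P @ [x]) \<and>
    length (reading_word (eg_insert x P)) = length (reading_word P) + 1 \<and>
    set (reading_word (eg_insert x P)) = insert x (set (reading_word P))"
    using assms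
  proof (induction rule: eg_insert_induct)
    case (bump x R y R' P)
    have "word_perm (reading_word (eg_insert x (R # P))) = word_perm (reading_word P @ [y]) \<circ> word_perm R'"
      using bump(6) by (simp only: bump_eg_insert[OF bump(3)] reading_word_Cons word_perm_append)
    also have "\<dots> = word_perm (reading_word P) \<circ> word_perm (y # R')"
      by (simp flip: word_perm_append)
    also have "\<dots> = word_perm (reading_word P) \<circ> word_perm (R @ [x])"
      by (simp only: bump_word_perm[OF bump(3)])
    finally have "word_perm (reading_word (eg_insert x (R # P))) = word_perm (reading_word (R # P) @ [x])"
      by (simp flip: word_perm_append)
    then show ?case
      using bump(6) bump_insert_set[OF bump(3)]
      by (simp add: bump_eg_insert[OF bump(3)] bump_length[OF bump(3)]) blast
  qed (simp_all add: eg_insert_append)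
  then show "word_perm (reading_word (eg_insert x P)) = word_perm (reading_word P @ [x])"
    and "length (reading_word (eg_insert x P)) = length (reading_word P) + 1"
    and "set (reading_word (eg_insert x P)) = insert x (set (reading_word P))"
    by simp_all
qed

text \<open>
  With \<open>v\<close> the letters still to be inserted, this is the invariant of the insertion process, and also of
  its reversal.
\<close>

lemma reduced_eg_insert:
  assumes "eg_tableau n P" "reduced n (reading_word P @ [x])"
  shows "reduced n (reading_word (eg_insert x P) @ v) \<longleftrightarrow> reduced n (reading_word P @ x # v)"
proof (rule reduced_cong)
  show "word_perm (reading_word (eg_insert x P) @ v) = word_perm (reading_word P @ x # v)"
    using word_perm_eg_insert[OF assms] word_perm_append[of "reading_word P @ [x]" v]
    by (simp add: word_perm_append[of _ v])
qed (simp_all add: length_eg_insert[OF assms] set_eg_insert[OF assms])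

lemma eg_tableau_eg_insert:
  assumes "eg_tableau n P" "reduced n (reading_word P @ [x])"
  shows "eg_tableau n (eg_insert x P)"
  using assms
proof (induction rule: eg_insert_induct)
  case (Nil x)
  then show ?case by (simp add: eg_tableau_def)
next
  case (append x R P)
  have "column_strict (R @ [x]) S" if "column_strict R S" for S
    using that unfolding column_strict_def by (auto intro: le_trans)
  then show ?case
    using append by (auto simp: eg_insert_append eg_tableau_Cons sorted_wrt_append)
next
  case (bump x R y R' P)
  then have "eg_tableau n P" by (simp add: eg_tableau_Cons)
  then have "reduced n (reading_word (eg_insert y P) @ R')"
    using reduced_eg_insert bump(4,5) by blast
  moreover have "R' \<noteq> []"
    using bump_mem(3)[OF bump(3)] by auto
  ultimately show ?case
    using bump bump_sorted(2)[OF bump(3)] column_strict_eg_insert[OF bump(1,3,5)]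
    by (simp add: bump_eg_insert eg_tableau_Cons)
qed

section \<open>Growth of the shape and reverse insertion\<close>

lemma young_diagram_Nil [simp]: "young_diagram [] = {}"
  by (auto simp: young_diagram_def)

lemma young_diagram_Cons:
  "(i, j) \<in> young_diagram (k # \<mu>) \<longleftrightarrow>
     i = 1 \<and> 1 \<le> j \<and> j \<le> k \<or> 2 \<le> i \<and> (i - 1, j) \<in> young_diagram \<mu>"
  unfolding young_diagram_def by (cases i; cases "i - 1") auto

lemma tab_shape_Nil [simp]: "tab_shape [] = []"
  by (simp add: tab_shape_def)

lemma tab_shape_Cons [simp]: "tab_shape (R # P) = length R # tab_shape P"
  by (simp add: tab_shape_def)

text \<open>
  A cell added to the lower rows, seen from the whole diagram.
\<close>

lemma young_diagram_insert_below:
  assumes "(i, j) \<notin> young_diagram \<mu>" "young_diagram \<mu>' = insert (i, j) (young_diagram \<mu>)"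
  shows "(Suc i, j) \<notin> young_diagram (k # \<mu>)"
    and "young_diagram (k # \<mu>') = insert (Suc i, j) (young_diagram (k # \<mu>))"
proof -
  have "1 \<le> i"
  proof -
    have "(i, j) \<in> young_diagram \<mu>'" using assms(2) by simp
    then show ?thesis by (simp add: young_diagram_def)
  qed
  then show "(Suc i, j) \<notin> young_diagram (k # \<mu>)"
    using assms(1) by (simp add: young_diagram_Cons)
  show "young_diagram (k # \<mu>') = insert (Suc i, j) (young_diagram (k # \<mu>))"
  proof (intro set_eqI)
    fix c :: "nat \<times> nat"
    obtain a b where c: "c = (a, b)" by (cases c)
    show "c \<in> young_diagram (k # \<mu>') \<longleftrightarrow> c \<in> insert (Suc i, j) (young_diagram (k # \<mu>))"
      using \<open>1 \<le> i\<close> by (auto simp: c young_diagram_Cons assms(2))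
  qed
qed

lemma young_diagram_insert_top:
  "(1, k + 1) \<notin> young_diagram (k # \<mu>)"
  "young_diagram ((k + 1) # \<mu>) = insert (1, k + 1) (young_diagram (k # \<mu>))"
  by (auto simp: young_diagram_Cons set_eq_iff)

lemma cells_eg_insert:
  assumes "eg_tableau n P" "reduced n (reading_word P @ [x])"
  shows "\<exists>c. c \<notin> cells P \<and> cells (eg_insert x P) = insert c (cells P)"
  using assms
proof (induction rule: eg_insert_induct)
  case (Nil x)
  have "young_diagram [Suc 0] = {(1, 1)}"
    by (auto simp: young_diagram_Cons set_eq_iff)
  then show ?case by simp
next
  case (append x R P)
  then show ?case
    using young_diagram_insert_top[of "length R" "tab_shape P"] by (auto simp: eg_insert_append)
next
  case (bump x R y R' P)
  then obtain i j where "(i, j) \<notin> cells P" "cells (eg_insert y P) = insert (i, j) (cells P)"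
    by auto
  from young_diagram_insert_below[OF this, of "length R"] show ?case
    using bump by (auto simp: bump_eg_insert bump_length)
qed

lemma eg_insert_hd_mem:
  assumes "eg_tableau n P" "reduced n (reading_word P @ [x])"
  shows "x \<in> set (hd (eg_insert x P))"
  using assms
  by (induction rule: eg_insert_induct) (auto simp: eg_insert_append bump_eg_insert bump_mem)

text \<open>
  Removing the last entry of a row destroys no column as long as the row below is not too long.
\<close>

lemma column_strict_butlast:
  assumes "column_strict (R @ [x]) S" "length S \<le> length R" "\<forall>z \<in> set R. z < x"
  shows "column_strict R S"
  unfolding column_strict_def
proof
  fix t
  show "count_less (t + 1) S \<le> count_less t R"
  proof (cases "x < t")
    case True
    then have "count_less t R = length R"
      using assms(3) by (intro count_less_all) auto
    then show ?thesis
      using count_less_le_length[of "t + 1" S] assms(2) by simp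
  next
    case False
    then show ?thesis
      using assms(1)[unfolded column_strict_def, rule_format, of t] by simp
  qed
qed

text \<open>
  The corner entry is taken out of its row and pushed upwards by reversed bumps. A row can be bumped
  backwards if it has an entry below the \<open>y\<close> that arrives from the next row; this is where strict
  columns are needed, and why the lemmas above show that they survive the reversal.
\<close>

lemma eg_uninsert:
  assumes "eg_tableau n P" "(i, j) \<in> cells P" "(i, j + 1) \<notin> cells P" "(i + 1, j) \<notin> cells P"
  shows "\<exists>x P'. eg_tableau n P' \<and> reduced n (reading_word P' @ [x]) \<and> eg_insert x P' = P \<and>
    (i, j) \<notin> cells P' \<and> cells P = insert (i, j) (cells P')"
  using assms
proof (induction P arbitrary: i)
  case Nil
  then show ?case by simp
next
  case (Cons R' P)
  show ?case
  proof (cases "i = 1")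
    case True
    then have j: "j = length R'" "R' \<noteq> []"
      using Cons.prems by (auto simp: young_diagram_Cons)
    define R x where "R = butlast R'" and "x = last R'"
    have R': "R' = R @ [x]"
      using j by (simp add: R_def x_def)
    have R: "\<forall>z \<in> set R. z < x" "sorted_wrt (<) R"
      using Cons.prems(1) by (auto simp: eg_tableau_Cons R' sorted_wrt_append)
    have len: "P = [] \<or> length (hd P) \<le> length R"
      using Cons.prems(4) j True
      by (cases P) (auto simp: young_diagram_Cons R' not_le)
    show ?thesis
    proof (cases "R = []")
      case True
      then have "P = []"
        using len Cons.prems(1) by (cases P) (auto simp: eg_tableau_Cons)
      have "young_diagram [Suc 0] = {(1, 1)}"
        by (auto simp: young_diagram_Cons set_eq_iff)
      then show ?thesis
        using Cons.prems(1) True \<open>P = []\<close> j \<open>i = 1\<close>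
        by (intro exI[of _ x] exI[of _ "[]"]) (simp add: R' eg_tableau_Nil eg_tableau_Cons)
    next
      case False
      have "eg_tableau n (R # P)"
        using Cons.prems(1) R False len column_strict_butlast[of R x "hd P"]
          reduced_prefix[of n "reading_word P @ R" "[x]"]
        by (auto simp: eg_tableau_Cons R')
      then show ?thesis
        using Cons.prems(1) R j \<open>i = 1\<close> young_diagram_insert_top[of "length R" "tab_shape P"]
        by (intro exI[of _ x] exI[of _ "R # P"]) (simp add: R' eg_insert_append eg_tableau_Cons)
    qed
  next
    case False
    then obtain i' where i: "i = Suc i'" "1 \<le> i'"
      using Cons.prems(2) by (cases i) (auto simp: young_diagram_Cons)
    have RP: "eg_tableau n P" "reduced n (reading_word P @ R')" "sorted_wrt (<) R'"
      and cs: "P = [] \<or> column_strict R' (hd P)"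
      using Cons.prems(1) by (auto simp: eg_tableau_Cons)
    have "(i', j) \<in> cells P" "(i', j + 1) \<notin> cells P" "(i' + 1, j) \<notin> cells P"
      using Cons.prems i by (auto simp: young_diagram_Cons)
    from Cons.IH[OF RP(1) this] obtain y P' where P': "eg_tableau n P'"
      "reduced n (reading_word P' @ [y])" "eg_insert y P' = P"
      "(i', j) \<notin> cells P'" "cells P = insert (i', j) (cells P')" by blast
    have "y \<in> set (hd P)"
      using eg_insert_hd_mem[OF P'(1,2)] P'(3) by simp
    moreover have cs: "column_strict R' (hd P)"
      using cs eg_insert_neq_Nil[of y P'] P'(3) by blast
    ultimately have "\<exists>z \<in> set R'. z < y"
      by (rule column_strict_mem[rotated])
    have red: "reduced n (reading_word P' @ y # R')"
      using reduced_eg_insert[OF P'(1,2)] P'(3) RP(2) by simp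
    obtain x R where bump: "bump x R y R'"
      using bump_exists_reverse[OF reduced_suffix[OF red] RP(3) \<open>\<exists>z \<in> set R'. z < y\<close>] by blast
    have red': "reduced n (reading_word P' @ R @ [x])"
      using red reduced_bump[OF bump] by blast
    have "P' = [] \<or> column_strict R (hd P')"
    proof (cases P')
      case (Cons S Q)
      show ?thesis
      proof (cases "\<forall>z \<in> set S. z < y")
        case True
        then show ?thesis
          using column_strict_unbump_append[OF _ bump] cs P'(3) Cons by (auto simp: eg_insert_append)
      next
        case False
        moreover have "reduced n (S @ [y])" "sorted_wrt (<) S"
          using P'(1,2) Cons reduced_suffix[of n "reading_word Q" "S @ [y]"]
          by (auto simp: eg_tableau_Cons)
        ultimately obtain z S' where "bump y S z S'"
          using bump_exists[of n S y] by metis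
        then show ?thesis
          using column_strict_unbump_bump[OF _ bump] cs P'(3) Cons by (auto simp: bump_eg_insert)
      qed
    qed simp
    moreover have "R \<noteq> []"
      using bump_mem(2)[OF bump] by auto
    ultimately have "eg_tableau n (R # P')"
      using P'(1) bump_sorted(1)[OF bump] reduced_prefix[of n "reading_word P' @ R" "[x]"] red'
      by (simp add: eg_tableau_Cons)
    then show ?thesis
      using red' P'(3) bump_eg_insert[OF bump] young_diagram_insert_below[OF P'(4,5), of "length R"] i
      by (intro exI[of _ x] exI[of _ "R # P'"]) (simp add: bump_length[OF bump])
  qed
qed

text \<open>
  Equal shapes before the insertion force both insertions to end in the same row; all rows above are
  recovered by reversing bumps, from the bottom row of the path to the first one.
\<close>

lemma eg_insert_inj:
  assumes "eg_tableau n P" "reduced n (reading_word P @ [x])"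
    and "eg_tableau n P2" "reduced n (reading_word P2 @ [x2])"
    and "tab_shape P = tab_shape P2" "eg_insert x P = eg_insert x2 P2"
  shows "x = x2 \<and> P = P2"
  using assms
proof (induction arbitrary: x2 P2 rule: eg_insert_induct)
  case (Nil x)
  then show ?case by (cases P2) auto
next
  case (append x R P)
  then obtain R2 Q2 where P2: "P2 = R2 # Q2" "length R2 = length R"
    by (cases P2) auto
  have "\<forall>z \<in> set R2. z < x2"
  proof (rule ccontr)
    assume "\<not> ?thesis"
    moreover have "reduced n (R2 @ [x2])" "sorted_wrt (<) R2"
      using append.prems(1,2) P2 reduced_suffix[of n "reading_word Q2" "R2 @ [x2]"]
      by (auto simp: eg_tableau_Cons)
    ultimately obtain y R2' where "bump x2 R2 y R2'"
      using bump_exists[of n R2 x2] by metis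
    then have "length (hd (eg_insert x2 P2)) = length R2"
      by (simp add: P2 bump_eg_insert bump_length)
    then show False
      using append.prems(4) append.hyps(3) P2
      by (metis eg_insert_append length_append_singleton list.sel(1) n_not_Suc_n)
  qed
  then show ?case
    using append P2 by (simp add: eg_insert_append)
next
  case (bump x R y R' P)
  then obtain R2 Q2 where P2: "P2 = R2 # Q2" "length R2 = length R"
    by (cases P2) auto
  have *: "eg_insert x2 P2 = R' # eg_insert y P"
    using bump by (simp add: bump_eg_insert)
  have red2: "reduced n (reading_word Q2 @ R2 @ [x2])" and "sorted_wrt (<) R2"
    using bump.prems(1,2) P2 by (simp_all add: eg_tableau_Cons)
  have "\<not> (\<forall>z \<in> set R2. z < x2)"
  proof
    assume "\<forall>z \<in> set R2. z < x2"
    then have "R2 @ [x2] = R'" using * P2 by (simp add: eg_insert_append)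
    then show False using bump_length[OF bump(3)] P2 by auto
  qed
  then obtain y2 R2' where b2: "bump x2 R2 y2 R2'"
    using bump_exists[OF reduced_suffix[OF red2] \<open>sorted_wrt (<) R2\<close>] by blast
  then have eq: "R2' = R'" "eg_insert y P = eg_insert y2 Q2"
    using * by (simp_all add: P2 bump_eg_insert)
  have red2': "reduced n (reading_word Q2 @ y2 # R2')"
    using red2 reduced_bump[OF b2] by blast
  then have "reduced n (reading_word Q2 @ [y2])"
    using reduced_prefix[of n "reading_word Q2 @ [y2]" R2'] by simp
  then have "y = y2 \<and> P = Q2"
    using bump.prems bump.IH[of Q2 y2] eq P2 by (simp add: eg_tableau_Cons)
  moreover from this have "x = x2 \<and> R = R2"
    using bump_inj[OF bump(3)] b2 eq by blast
  ultimately show ?case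
    using P2 by simp
qed


section \<open>Insertion and recording tableaux of reduced words\<close>

lemma P_tab_Nil [simp]: "P_tab [] = []"
  by (simp add: P_tab_def)

lemma P_tab_snoc: "P_tab (w @ [x]) = eg_insert x (P_tab w)"
  by (simp add: P_tab_def)

text \<open>
  The last equivalence makes the next letter admissible for the tableau, which is what the lemmas on a
  single insertion require.
\<close>

lemma P_tab_reduced:
  assumes "reduced n w"
  shows eg_tableau_P_tab: "eg_tableau n (P_tab w)"
    and word_perm_P_tab: "word_perm (reading_word (P_tab w)) = word_perm w"
    and length_P_tab: "length (reading_word (P_tab w)) = length w"
    and reduced_reading_word_P_tab: "reduced n (reading_word (P_tab w) @ v) \<longleftrightarrow> reduced n (w @ v)"
proof -
  have "eg_tableau n (P_tab w) \<and> word_perm (reading_word (P_tab w)) = word_perm w \<and>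
    length (reading_word (P_tab w)) = length w \<and>
    (\<forall>v. reduced n (reading_word (P_tab w) @ v) \<longleftrightarrow> reduced n (w @ v))"
    using assms
  proof (induction w rule: rev_induct)
    case Nil
    show ?case by (simp add: eg_tableau_Nil)
  next
    case (snoc x w)
    then have IH: "eg_tableau n (P_tab w)" "word_perm (reading_word (P_tab w)) = word_perm w"
      "length (reading_word (P_tab w)) = length w"
      "\<And>v. reduced n (reading_word (P_tab w) @ v) \<longleftrightarrow> reduced n (w @ v)"
      using reduced_prefix by blast+
    have red: "reduced n (reading_word (P_tab w) @ [x])"
      using IH(4) snoc.prems by blast
    show ?case
      using eg_tableau_eg_insert[OF IH(1) red] eg_insert_reading_word[OF IH(1) red]
        reduced_eg_insert[OF IH(1) red] IH
      by (simp add: P_tab_snoc word_perm_snoc)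
  qed
  then show "eg_tableau n (P_tab w)" "word_perm (reading_word (P_tab w)) = word_perm w"
    "length (reading_word (P_tab w)) = length w"
    "reduced n (reading_word (P_tab w) @ v) \<longleftrightarrow> reduced n (w @ v)"
    by blast+
qed

lemma is_partition_tab_shape:
  assumes "eg_tableau n P"
  shows "is_partition (tab_shape P)"
proof -
  have "successively (\<ge>) (tab_shape P)"
    using assms column_strict_length unfolding eg_tableau_def tab_shape_def successively_map
    by (auto elim: successively_mono)
  then have "sorted_wrt (\<ge>) (tab_shape P)"
    by (subst successively_conv_sorted_wrt[symmetric]) (auto simp: transp_def)
  then show ?thesis
    using assms by (auto simp: is_partition_def eg_tableau_def tab_shape_def)
qed

lemma sum_list_tab_shape: "sum_list (tab_shape P) = length (reading_word P)"
  by (induction P) auto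

lemma is_partition_down:
  assumes "is_partition \<mu>" "(i, j) \<in> young_diagram \<mu>" "1 \<le> i'" "i' \<le> i" "1 \<le> j'" "j' \<le> j"
  shows "(i', j') \<in> young_diagram \<mu>"
proof -
  have "\<mu> ! (i - 1) \<le> \<mu> ! (i' - 1)"
    using assms by (cases "i' = i")
      (auto simp: is_partition_def young_diagram_def sorted_wrt_iff_nth_less)
  then show ?thesis
    using assms by (auto simp: young_diagram_def)
qed

lemma tableau_eqI:
  assumes "tab_shape T = tab_shape U"
    and "\<And>i j. (i, j) \<in> cells T \<Longrightarrow> entry T i j = entry U i j"
  shows "T = U"
proof (rule nth_equalityI)
  show len: "length T = length U"
    using assms(1) by (metis length_map tab_shape_def)
  fix i assume i: "i < length T"
  have len_i: "length (T ! i) = length (U ! i)"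
    using assms(1) i len by (metis nth_map tab_shape_def)
  show "T ! i = U ! i"
  proof (rule nth_equalityI[OF len_i])
    fix j assume "j < length (T ! i)"
    then show "T ! i ! j = U ! i ! j"
      using assms(2)[of "i + 1" "j + 1"] i by (simp add: young_diagram_def tab_shape_def entry_def)
  qed
qed

lemma tab_shape_EG [simp]: "tab_shape (EG w) = tab_shape (P_tab w)"
  by (rule nth_equalityI) (simp_all add: EG_def tab_shape_def del: upt_Suc)

lemma entry_map_upt:
  assumes "1 \<le> i" "i \<le> l" "1 \<le> j" "j \<le> r i"
  shows "entry (map (\<lambda>i. map (F i) [1..<r i + 1]) [1..<l + 1]) i j = F i j"
proof -
  have "[1..<l + 1] ! (i - 1) = i" "[1..<r i + 1] ! (j - 1) = j"
    using assms by (subst nth_upt; simp)+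
  then show ?thesis
    using assms by (simp add: entry_def del: upt_Suc)
qed

lemma entry_EG:
  assumes "(i, j) \<in> cells (P_tab w)"
  shows "entry (EG w) i j = (THE k. 1 \<le> k \<and> k \<le> length w \<and>
    (i, j) \<in> cells (P_tab (take k w)) - cells (P_tab (take (k - 1) w)))"
  unfolding EG_def
  by (rule entry_map_upt) (use assms in \<open>simp_all add: young_diagram_def tab_shape_def\<close>)

text \<open>
  Each insertion creates one cell, so the entries of the recording tableau enumerate the cells in the
  order of their creation, and the shapes at all intermediate steps can be read off from it.
\<close>

lemma EG_growth:
  assumes "reduced n w"
  shows "bij_betw (\<lambda>(i, j). entry (EG w) i j) (cells (P_tab w)) {1..length w}" (is "bij_betw ?e _ _")
    and "\<And>k. k \<le> length w \<Longrightarrow>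
      cells (P_tab (take k w)) = {c \<in> cells (P_tab w). (case c of (i, j) \<Rightarrow> entry (EG w) i j) \<le> k}"
proof -
  let ?C = "\<lambda>k. cells (P_tab (take k w))"
  have "\<exists>c. c \<notin> ?C k \<and> ?C (Suc k) = insert c (?C k)" if "k < length w" for k
  proof -
    have "reduced n (take (Suc k) w)"
      using assms reduced_prefix[of n "take (Suc k) w" "drop (Suc k) w"] by simp
    then have red: "reduced n (take k w @ [w ! k])"
      using that by (simp add: take_Suc_conv_app_nth)
    note prefix = reduced_prefix[OF red]
    have "reduced n (reading_word (P_tab (take k w)) @ [w ! k])"
      using red reduced_reading_word_P_tab[OF prefix] by blast
    from cells_eg_insert[OF eg_tableau_P_tab[OF prefix] this] show ?thesis
      using that by (simp add: take_Suc_conv_app_nth P_tab_snoc)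
  qed
  \<comment> \<open>Counted from 0: the letter at index \<open>k\<close> is inserted at step \<open>k + 1\<close> and creates \<open>c k\<close>.\<close>
  then obtain c where c: "\<And>k. k < length w \<Longrightarrow> c k \<notin> ?C k \<and> ?C (Suc k) = insert (c k) (?C k)"
    by metis
  have C: "?C k = c ` {..<k}" if "k \<le> length w" for k
    using that by (induction k) (auto simp: c lessThan_Suc)
  have inj: "c k = c l \<longleftrightarrow> k = l" if "k < length w" "l < length w" for k l
  proof -
    have "c l \<noteq> c k" if "k < l" "l < length w" for k l
      using c[of l] that by (auto simp: C)
    then show ?thesis using that by (metis linorder_neqE_nat)
  qed
  have e: "?e (c k) = Suc k" if "k < length w" for k
  proof -
    obtain i j where ij: "c k = (i, j)" by (cases "c k")
    have "(i, j) \<in> cells (P_tab w)"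
      using C[of "length w"] that ij by force
    then have "entry (EG w) i j = (THE m. 1 \<le> m \<and> m \<le> length w \<and> (i, j) \<in> ?C m - ?C (m - 1))"
      by (rule entry_EG)
    also have "\<dots> = Suc k"
    proof (rule the_equality)
      show "1 \<le> Suc k \<and> Suc k \<le> length w \<and> (i, j) \<in> ?C (Suc k) - ?C (Suc k - 1)"
        using c[OF that] that ij by simp
      fix m assume m: "1 \<le> m \<and> m \<le> length w \<and> (i, j) \<in> ?C m - ?C (m - 1)"
      then have "c k = c (m - 1)"
        using c[of "m - 1"] ij by auto
      then show "m = Suc k"
        using inj[OF that, of "m - 1"] m by (cases m) auto
    qed
    finally show ?thesis by (simp add: ij)
  qed
  have P: "cells (P_tab w) = c ` {..<length w}"
    using C[of "length w"] by simp
  show "bij_betw ?e (cells (P_tab w)) {1..length w}"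
  proof (rule bij_betw_byWitness[where f' = "\<lambda>m. c (m - 1)"])
    show "\<forall>m \<in> {1..length w}. ?e (c (m - 1)) = m"
    proof
      fix m assume "m \<in> {1..length w}"
      then show "?e (c (m - 1)) = m" using e[of "m - 1"] by (cases m) auto
    qed
    show "(\<lambda>m. c (m - 1)) ` {1..length w} \<subseteq> cells (P_tab w)"
      unfolding P by (auto intro!: imageI)
  qed (simp_all add: P e image_subset_iff Suc_le_eq)
  show "?C k = {c \<in> cells (P_tab w). ?e c \<le> k}" if "k \<le> length w" for k
  proof -
    have "{m \<in> {..<length w}. ?e (c m) \<le> k} = {m \<in> {..<length w}. Suc m \<le> k}"
      using e by (intro Collect_cong conj_cong) simp_all
    also have "\<dots> = {..<k}"
      using that by auto
    finally have "?C k = c ` {m \<in> {..<length w}. ?e (c m) \<le> k}"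
      using C[OF that] by simp
    also have "\<dots> = {x \<in> c ` {..<length w}. ?e x \<le> k}"
      by blast
    finally show ?thesis
      unfolding P .
  qed
qed

text \<open>
  All intermediate shapes are partitions, so no cell is created before the cells weakly to the left and
  above it.
\<close>

lemma EG_SYT:
  assumes "reduced n w"
  shows "EG w \<in> SYT (tab_shape (P_tab w))"
proof -
  let ?\<mu> = "tab_shape (P_tab w)" and ?e = "entry (EG w)"
  note bij = EG_growth(1)[OF assms] and cells = EG_growth(2)[OF assms]
  have range: "1 \<le> ?e i j" "?e i j \<le> length w" if "(i, j) \<in> young_diagram ?\<mu>" for i j
    using bij_betwE[OF bij] that by auto
  have mono: "?e i j < ?e i' j'"
    if "(i, j) \<in> young_diagram ?\<mu>" "(i', j') \<in> young_diagram ?\<mu>" "i \<le> i'" "j \<le> j'" "(i, j) \<noteq> (i', j')" for i j i' j'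
  proof -
    let ?k = "?e i' j'"
    have "reduced n (take ?k w)"
      using assms reduced_prefix[of n "take ?k w" "drop ?k w"] by simp
    then have "is_partition (tab_shape (P_tab (take ?k w)))"
      by (intro is_partition_tab_shape eg_tableau_P_tab)
    moreover have "(i', j') \<in> cells (P_tab (take ?k w))"
      using cells[of ?k] range[OF that(2)] that(2) by simp
    ultimately have "(i, j) \<in> cells (P_tab (take ?k w))"
      by (rule is_partition_down) (use that in \<open>auto simp: young_diagram_def\<close>)
    then have "?e i j \<le> ?k"
      using cells[of ?k] range[OF that(2)] by simp
    moreover have "?e i j \<noteq> ?k"
      using inj_onD[OF bij_betw_imp_inj_on[OF bij], of "(i, j)" "(i', j')"] that by auto
    ultimately show ?thesis by simp
  qed
  show ?thesis
    unfolding SYT_def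
    using bij mono length_P_tab[OF assms] by (simp add: sum_list_tab_shape)
qed

text \<open>
  A standard tableau is determined by the shapes of its initial segments.
\<close>

lemma EG_eqI:
  assumes "reduced n w" "T \<in> SYT (tab_shape (P_tab w))"
    and "\<And>k. k \<le> length w \<Longrightarrow>
      cells (P_tab (take k w)) = {c \<in> cells (P_tab w). (case c of (i, j) \<Rightarrow> entry T i j) \<le> k}"
  shows "EG w = T"
proof (rule tableau_eqI)
  show "tab_shape (EG w) = tab_shape T"
    using assms(2) by (simp add: SYT_def)
  fix i j assume "(i, j) \<in> cells (EG w)"
  then have ij: "(i, j) \<in> cells (P_tab w)" by simp
  have "bij_betw (\<lambda>(i, j). entry T i j) (cells (P_tab w)) {1..length w}"
    using assms(2) by (simp add: SYT_def sum_list_tab_shape length_P_tab[OF assms(1)])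
  then have T: "entry T i j \<le> length w"
    using bij_betwE ij by fastforce
  have E: "entry (EG w) i j \<le> length w"
    using bij_betwE[OF EG_growth(1)[OF assms(1)]] ij by fastforce
  have "entry (EG w) i j \<le> k \<longleftrightarrow> entry T i j \<le> k" if "k \<le> length w" for k
  proof -
    have "(i, j) \<in> {c \<in> cells (P_tab w). (case c of (i, j) \<Rightarrow> entry (EG w) i j) \<le> k} \<longleftrightarrow>
        (i, j) \<in> {c \<in> cells (P_tab w). (case c of (i, j) \<Rightarrow> entry T i j) \<le> k}"
      using EG_growth(2)[OF assms(1) that] assms(3)[OF that] by simp
    then show ?thesis using ij by simp
  qed
  from this[OF T] this[OF E] show "entry (EG w) i j = entry T i j" by simp
qed

text \<open>
  Knowing all intermediate shapes, one undoes the insertions one by one from the last letter.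
\<close>

lemma P_tab_inj:
  assumes "reduced n w" "reduced n w2" "length w = length w2" "P_tab w = P_tab w2"
    and "\<And>k. k \<le> length w \<Longrightarrow> cells (P_tab (take k w)) = cells (P_tab (take k w2))"
  shows "w = w2"
  using assms
proof (induction w arbitrary: w2 rule: rev_induct)
  case Nil
  then show ?case by simp
next
  case (snoc x w)
  obtain x2 v where w2: "w2 = v @ [x2]" "length v = length w"
    using snoc.prems(3) by (cases w2 rule: rev_cases) auto
  have red: "reduced n w" "reduced n v"
    using snoc.prems(1,2) w2 reduced_prefix by blast+
  have "cells (P_tab w) = cells (P_tab v)"
    using snoc.prems(5)[of "length w"] w2 by simp
  then have shape: "tab_shape (P_tab w) = tab_shape (P_tab v)"
    using red by (intro young_diagram_inj is_partition_tab_shape eg_tableau_P_tab)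
  have "x = x2 \<and> P_tab w = P_tab v"
    using eg_insert_inj[OF eg_tableau_P_tab[OF red(1)] _ eg_tableau_P_tab[OF red(2)] _ shape]
      reduced_reading_word_P_tab[OF red(1)] reduced_reading_word_P_tab[OF red(2)] snoc.prems(1,2,4) w2
    by (simp add: P_tab_snoc)
  moreover have "w = v"
  proof (rule snoc.IH[OF red])
    show "P_tab w = P_tab v" using calculation by simp
    show "cells (P_tab (take k w)) = cells (P_tab (take k v))" if "k \<le> length w" for k
      using snoc.prems(5)[of k] that w2 by simp
  qed (simp add: w2)
  ultimately show ?case using w2 by simp
qed

lemma EG_inj:
  assumes "reduced n w" "reduced n w2" "P_tab w = P_tab w2" "EG w = EG w2"
  shows "w = w2"
proof (rule P_tab_inj[OF assms(1,2) _ assms(3)])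
  show len: "length w = length w2"
    using length_P_tab[OF assms(1)] length_P_tab[OF assms(2)] assms(3) by simp
  show "cells (P_tab (take k w)) = cells (P_tab (take k w2))" if "k \<le> length w" for k
    using EG_growth(2)[OF assms(1) that] EG_growth(2)[OF assms(2), of k] that len assms(3,4) by simp
qed

text \<open>
  The word is recovered from its last letter on: the cells of \<open>T\<close> with the entries \<open>N, N - 1, \<dots>, 1\<close>
  are removed in this order by reverse insertion. Each of them is a corner at its turn because the
  entries of \<open>T\<close> increase along rows and columns.
\<close>

lemma EG_surj:
  assumes P: "eg_tableau n P" and T: "T \<in> SYT (tab_shape P)"
  shows "\<exists>w. reduced n w \<and> P_tab w = P \<and> EG w = T"
proof -
  let ?ins = "foldl (\<lambda>P x. eg_insert x P)"
  let ?e = "\<lambda>(i, j). entry T i j"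
  define N where "N = length (reading_word P)"
  have bij: "bij_betw ?e (cells P) {1..N}"
    using T by (simp add: SYT_def sum_list_tab_shape N_def)
  have row: "entry T i j < entry T i (j + 1)" if "(i, j) \<in> cells P" "(i, j + 1) \<in> cells P" for i j
    using T that by (auto simp: SYT_def)
  have col: "entry T i j < entry T (i + 1) j" if "(i, j) \<in> cells P" "(i + 1, j) \<in> cells P" for i j
    using T that by (auto simp: SYT_def)
  \<comment> \<open>\<open>v\<close> consists of the last \<open>d\<close> letters, and \<open>P'\<close> is the tableau before their insertion.\<close>
  have "\<exists>P' v. length v = d \<and> eg_tableau n P' \<and> reduced n (reading_word P' @ v) \<and> ?ins P' v = P \<and>
      (\<forall>k \<le> d. cells (?ins P' (take k v)) = {c \<in> cells P. ?e c \<le> N - d + k})" if "d \<le> N" for d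
    using that
  proof (induction d)
    case 0
    have "cells P = {c \<in> cells P. ?e c \<le> N}"
      using bij_betwE[OF bij] by auto
    then show ?case
      using P by (intro exI[of _ P] exI[of _ "[]"]) (simp add: eg_tableau_def)
  next
    case (Suc d)
    define m where "m = N - d"
    obtain P1 v where v: "length v = d" "eg_tableau n P1" "reduced n (reading_word P1 @ v)" "?ins P1 v = P"
      and cells: "\<And>k. k \<le> d \<Longrightarrow> cells (?ins P1 (take k v)) = {c \<in> cells P. ?e c \<le> m + k}"
      using Suc m_def by auto
    have P1: "cells P1 = {c \<in> cells P. ?e c \<le> m}"
      using cells[of 0] by simp
    have "m \<in> {1..N}"
      using Suc.prems by (auto simp: m_def)
    then have "m \<in> ?e ` cells P"
      using bij_betw_imp_surj_on[OF bij] by simp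
    then obtain i j where ij: "(i, j) \<in> cells P" "entry T i j = m"
      by auto
    have "(i, j) \<in> cells P1"
      using ij P1 by simp
    moreover have "(i, j + 1) \<notin> cells P1"
      using row[OF ij(1)] ij(2) P1 by auto
    moreover have "(i + 1, j) \<notin> cells P1"
      using col[OF ij(1)] ij(2) P1 by auto
    ultimately obtain x P' where P': "eg_tableau n P'" "reduced n (reading_word P' @ [x])"
      "eg_insert x P' = P1" "(i, j) \<notin> cells P'" "cells P1 = insert (i, j) (cells P')"
      using eg_uninsert[OF v(2)] by blast
    have uniq: "?e c = m \<longleftrightarrow> c = (i, j)" if "c \<in> cells P" for c
    proof
      assume "?e c = m"
      then have "?e c = ?e (i, j)" using ij(2) by simp
      then show "c = (i, j)"
        by (rule inj_onD[OF bij_betw_imp_inj_on[OF bij]]) (use that ij(1) in simp_all)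
    qed (simp add: ij)
    have "cells P' = cells P1 - {(i, j)}"
      using P'(4,5) by simp
    also have "\<dots> = {c \<in> cells P. ?e c \<le> m \<and> ?e c \<noteq> m}"
      unfolding P1 using uniq by blast
    also have "\<dots> = {c \<in> cells P. ?e c \<le> N - Suc d}"
      using Suc.prems by (intro Collect_cong conj_cong refl) (simp add: m_def, linarith)
    finally have cells': "cells P' = {c \<in> cells P. ?e c \<le> N - Suc d}" .
    have "reduced n (reading_word P' @ x # v)"
      using reduced_eg_insert[OF P'(1,2)] P'(3) v(3) by simp
    moreover have "cells (?ins P' (take k (x # v))) = {c \<in> cells P. ?e c \<le> N - Suc d + k}"
      if "k \<le> Suc d" for k
    proof (cases k)
      case (Suc k')
      then have "N - Suc d + k = m + k'"
        using Suc.prems by (simp add: m_def)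
      moreover have "cells (?ins P' (take k (x # v))) = {c \<in> cells P. ?e c \<le> m + k'}"
        using cells[of k'] that Suc P'(3) by simp
      ultimately show ?thesis
        by (simp only:)
    qed (simp add: cells')
    ultimately show ?case
      using v P' by (intro exI[of _ P'] exI[of _ "x # v"]) simp
  qed
  from this[of N] obtain P' w where w: "length w = N" "eg_tableau n P'" "reduced n (reading_word P' @ w)"
    "?ins P' w = P" and cells: "\<And>k. k \<le> N \<Longrightarrow> cells (?ins P' (take k w)) = {c \<in> cells P. ?e c \<le> k}"
    by auto
  have "cells P' = {}"
    using cells[of 0] bij_betwE[OF bij] by fastforce
  have "P' = []"
  proof (cases P')
    case (Cons R P2)
    then have "1 \<le> length R"
      using w(2) by (simp add: eg_tableau_Cons Suc_le_eq)
    then have "(1, 1) \<in> cells P'"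
      by (simp add: Cons young_diagram_Cons)
    then show ?thesis using \<open>cells P' = {}\<close> by simp
  qed
  then have P_tab: "P_tab (take k w) = ?ins P' (take k w)" "P_tab w = P" for k
    using w(4) by (simp_all add: P_tab_def)
  have "reduced n w"
    using w(3) by (rule reduced_suffix)
  moreover have "EG w = T"
    by (rule EG_eqI[OF calculation]) (use T P_tab cells w(1) in simp_all)
  ultimately show ?thesis
    using P_tab by blast
qed

text \<open>
  The Edelman--Greene correspondence for one fixed insertion tableau.
\<close>

theorem EG_bij_betw:
  assumes "eg_tableau n P"
  shows "bij_betw EG {w. reduced n w \<and> P_tab w = P} (SYT (tab_shape P))"
  unfolding bij_betw_def
proof
  show "inj_on EG {w. reduced n w \<and> P_tab w = P}"
    by (auto intro!: inj_onI EG_inj)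
  show "EG ` {w. reduced n w \<and> P_tab w = P} = SYT (tab_shape P)"
    using EG_SYT EG_surj[OF assms] by fastforce
qed

section \<open>Frozen tableaux and their permutations\<close>

text \<open>
  The frozen tableau of shape \<open>\<mu>\<close> with all entries raised by \<open>a\<close>. The offset makes the definition
  recursive: removing the first row of a frozen tableau leaves a frozen tableau with offset raised by one.
\<close>

fun frozen_tab :: "nat \<Rightarrow> nat list \<Rightarrow> nat list list" where
  "frozen_tab a [] = []"
| "frozen_tab a (k # \<mu>) = [a + 1..<a + 1 + k] # frozen_tab (a + 1) \<mu>"

definition frozen_perm :: "nat \<Rightarrow> nat list \<Rightarrow> nat \<Rightarrow> nat" where
  "frozen_perm a \<mu> = word_perm (reading_word (frozen_tab a \<mu>))"

lemma tab_shape_frozen_tab [simp]: "tab_shape (frozen_tab a \<mu>) = \<mu>"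
  by (induction a \<mu> rule: frozen_tab.induct) auto

lemma entry_frozen_tab:
  assumes "(i, j) \<in> young_diagram \<mu>"
  shows "entry (frozen_tab a \<mu>) i j = a + i + j - 1"
  using assms
proof (induction a \<mu> arbitrary: i rule: frozen_tab.induct)
  case (2 a k \<mu>)
  show ?case
  proof (cases "i = 1")
    case True
    then have "1 \<le> j" "j \<le> k" using 2(2) by (auto simp: young_diagram_Cons)
    then have "[a + 1..<a + 1 + k] ! (j - 1) = a + j"
      by (subst nth_upt) auto
    then show ?thesis using True by (simp add: entry_def del: upt_Suc)
  next
    case False
    then have *: "2 \<le> i" "(i - 1, j) \<in> young_diagram \<mu>"
      using 2(2) by (auto simp: young_diagram_Cons)
    then have "entry (frozen_tab a (k # \<mu>)) i j = entry (frozen_tab (a + 1) \<mu>) (i - 1) j"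
      by (simp add: entry_def nth_Cons' del: upt_Suc)
    then show ?thesis using 2(1)[OF *(2)] * by simp
  qed
qed simp

lemma frozen_frozen_tab: "frozen (frozen_tab 0 \<mu>)"
  unfolding frozen_def using entry_frozen_tab[of _ _ \<mu> 0] by auto

lemma set_reading_word_frozen_tab:
  "set (reading_word (frozen_tab a \<mu>)) = {a + i + j - 1 | i j. (i, j) \<in> young_diagram \<mu>}"
proof (induction a \<mu> rule: frozen_tab.induct)
  case (2 a k \<mu>)
  show ?case (is "?L = ?R")
  proof
    show "?L \<subseteq> ?R"
    proof
      fix z assume "z \<in> ?L"
      then consider "a + 1 \<le> z" "z \<le> a + k" | "z \<in> set (reading_word (frozen_tab (a + 1) \<mu>))"
        by auto
      then show "z \<in> ?R"
      proof cases
        case 1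
        then have "z = a + 1 + (z - a) - 1" "(1, z - a) \<in> young_diagram (k # \<mu>)"
          by (auto simp: young_diagram_Cons)
        then show ?thesis by blast
      next
        case 2
        then obtain i j where "z = a + 1 + i + j - 1" "(i, j) \<in> young_diagram \<mu>"
          using \<open>set (reading_word (frozen_tab (a + 1) \<mu>)) = _\<close> by blast
        moreover have "1 \<le> i" using calculation by (simp add: young_diagram_def)
        ultimately have "z = a + (i + 1) + j - 1" "(i + 1, j) \<in> young_diagram (k # \<mu>)"
          by (auto simp: young_diagram_Cons)
        then show ?thesis by blast
      qed
    qed
    show "?R \<subseteq> ?L"
    proof
      fix z assume "z \<in> ?R"
      then obtain i j where ij: "z = a + i + j - 1" "(i, j) \<in> young_diagram (k # \<mu>)" by blast
      show "z \<in> ?L"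
      proof (cases "i = 1")
        case True
        then show ?thesis using ij by (auto simp: young_diagram_Cons)
      next
        case False
        then have "z = a + 1 + (i - 1) + j - 1" "(i - 1, j) \<in> young_diagram \<mu>"
          using ij by (auto simp: young_diagram_Cons)
        then show ?thesis using 2 by auto
      qed
    qed
  qed
qed simp

lemma frozen_tab_letters_gt: "z \<in> set (reading_word (frozen_tab a \<mu>)) \<Longrightarrow> a < z"
  by (auto simp: set_reading_word_frozen_tab young_diagram_def)

lemma word_perm_upt:
  "word_perm [b..<b + k] i = (if b \<le> i \<and> i < b + k then i + 1 else if i = b + k then b else i)"
proof (induction k arbitrary: i)
  case (Suc k)
  have "word_perm [b..<b + Suc k] i = word_perm [b..<b + k] (transpose (b + k) (b + k + 1) i)"
    by (simp add: word_perm_snoc)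
  then show ?case
    by (auto simp: Suc.IH transpose_def)
qed auto

lemma word_perm_le:
  assumes "\<forall>z \<in> set w. a < z" "i \<le> a"
  shows "word_perm w i = i"
  using assms by (intro word_perm_fixes) auto

lemma word_perm_gt:
  assumes "\<forall>z \<in> set w. a < z" "a < i"
  shows "a < word_perm w i"
proof (rule ccontr)
  assume "\<not> a < word_perm w i"
  then have "word_perm w (word_perm w i) = word_perm w i"
    using assms(1) by (intro word_perm_le) auto
  then have "word_perm w i = i"
    by (rule injD[OF word_perm_inj])
  then show False using \<open>\<not> a < word_perm w i\<close> assms(2) by simp
qed

lemma frozen_perm_Nil [simp]: "frozen_perm a [] = id"
  by (simp add: frozen_perm_def)

lemma frozen_perm_le: "i \<le> a \<Longrightarrow> frozen_perm a \<mu> i = i"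
  unfolding frozen_perm_def using frozen_tab_letters_gt by (intro word_perm_le) auto

lemma frozen_perm_gt: "a < i \<Longrightarrow> a < frozen_perm a \<mu> i"
  unfolding frozen_perm_def using frozen_tab_letters_gt by (intro word_perm_gt) auto

text \<open>
  The first row moves the value \<open>a + 1\<close>, which the lower rows leave at its place, \<open>k\<close> positions to the right.
\<close>

lemma frozen_perm_Cons:
  "frozen_perm a (k # \<mu>) i =
     (if a < i \<and> i \<le> a + k then frozen_perm (a + 1) \<mu> (i + 1)
      else if i = a + k + 1 then a + 1 else frozen_perm (a + 1) \<mu> i)"
proof -
  have "frozen_perm a (k # \<mu>) i = frozen_perm (a + 1) \<mu> (word_perm [a + 1..<a + 1 + k] i)"
    unfolding frozen_perm_def by (simp add: word_perm_append del: upt_Suc)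
  then show ?thesis
    unfolding word_perm_upt using frozen_perm_le[of "a + 1" "a + 1" \<mu>] by auto
qed

lemma is_partition_Cons:
  "is_partition (k # \<mu>) \<longleftrightarrow> is_partition \<mu> \<and> k \<noteq> 0 \<and> (\<forall>m \<in> set \<mu>. m \<le> k)"
  by (auto simp: is_partition_def)

text \<open>
  The value \<open>a + 1\<close> comes to the position \<open>a + m + 1\<close>, where \<open>m\<close> is the length of the first row, and is
  smaller than everything to its right; the positions after it are not affected by the first row, and
  the lower rows are at most as long. The bound \<open>k\<close> on all parts covers the empty partition, too.
\<close>

lemma frozen_perm_increasing:
  assumes "is_partition \<mu>" "\<forall>m \<in> set \<mu>. m \<le> k" "a + k < i" "i < j"
  shows "frozen_perm a \<mu> i < frozen_perm a \<mu> j"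
  using assms
proof (induction \<mu> arbitrary: a k)
  case Nil
  then show ?case by simp
next
  case (Cons m \<mu>)
  show ?case
  proof (cases "i = a + m + 1")
    case True
    then show ?thesis
      using frozen_perm_gt[of "a + 1" j \<mu>] Cons.prems(4) by (simp add: frozen_perm_Cons)
  next
    case False
    then have "a + 1 + m < i" using Cons.prems by simp
    moreover from this have "frozen_perm (a + 1) \<mu> i < frozen_perm (a + 1) \<mu> j"
      using Cons.prems by (intro Cons.IH[of m]) (auto simp: is_partition_Cons)
    ultimately show ?thesis
      using Cons.prems(4) by (simp add: frozen_perm_Cons)
  qed
qed

text \<open>
  Beyond position \<open>a\<close> the value \<open>a + 1\<close> is the minimum, so it can only be the first entry of a 132
  pattern; but from its position \<open>a + k + 1\<close> on the entries increase, so no pattern starts there or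
  further right. A pattern without this value comes from one of the permutation of the lower rows.
\<close>

lemma frozen_perm_avoids:
  assumes "is_partition \<mu>" "a < i" "i < j" "j < l"
  shows "\<not> (frozen_perm a \<mu> i < frozen_perm a \<mu> l \<and> frozen_perm a \<mu> l < frozen_perm a \<mu> j)"
  using assms
proof (induction \<mu> arbitrary: a i j l)
  case Nil
  then show ?case by simp
next
  case (Cons k \<mu>)
  show ?case
  proof (cases "a + k < i")
    case True
    then have "frozen_perm a (k # \<mu>) j < frozen_perm a (k # \<mu>) l"
      using Cons.prems by (intro frozen_perm_increasing[where k = k]) (auto simp: is_partition_Cons)
    then show ?thesis by simp
  next
    case False
    have gt: "a < frozen_perm a (k # \<mu>) x" if "a < x" for x
      using that by (rule frozen_perm_gt)
    have min: "frozen_perm a (k # \<mu>) (a + k + 1) = a + 1"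
      by (simp add: frozen_perm_Cons)
    show ?thesis
    proof (cases "j = a + k + 1 \<or> l = a + k + 1")
      case True
      then show ?thesis
        using gt[of i] gt[of l] min Cons.prems by auto
    next
      case neq: False
      \<comment> \<open>The position before the value \<open>a + 1\<close> was moved to the right.\<close>
      define p where "p x = (if x \<le> a + k then x + 1 else x)" for x
      have p: "frozen_perm a (k # \<mu>) x = frozen_perm (a + 1) \<mu> (p x)" if "a < x" "x \<noteq> a + k + 1" for x
        using that by (simp add: frozen_perm_Cons p_def)
      have "\<not> (frozen_perm (a + 1) \<mu> (p i) < frozen_perm (a + 1) \<mu> (p l) \<and>
          frozen_perm (a + 1) \<mu> (p l) < frozen_perm (a + 1) \<mu> (p j))"
        using Cons.prems False neq by (intro Cons.IH) (auto simp: is_partition_Cons p_def)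
      then show ?thesis
        using p[of i] p[of j] p[of l] neq False Cons.prems by simp
    qed
  qed
qed

text \<open>
  The value \<open>b\<close> passes one larger entry with each appended letter.
\<close>

lemma reduced_append_upt:
  assumes "reduced n w" "word_perm w b = b" "\<And>i. b < i \<Longrightarrow> b < word_perm w i"
    and "1 \<le> b" "b + k \<le> n \<or> k = 0"
  shows "reduced n (w @ [b..<b + k])"
  using assms(5)
proof (induction k)
  case 0
  then show ?case using assms(1) by simp
next
  case (Suc k)
  have "word_perm (w @ [b..<b + k]) (b + k) < word_perm (w @ [b..<b + k]) (b + k + 1)"
    using assms(2) assms(3)[of "b + k + 1"] by (simp add: word_perm_append word_perm_upt)
  moreover have "reduced n (w @ [b..<b + k])"
    using Suc by auto
  moreover have "b + k \<in> {1..n - 1}"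
    using Suc.prems assms(4) by auto
  ultimately have "reduced n ((w @ [b..<b + k]) @ [b + k])"
    by (simp only: reduced_snoc)
  then show ?case by simp
qed

lemma count_less_upt: "count_less t [b..<c] = min c t - b"
  by (induction c) (auto simp: count_less_def)

lemma eg_tableau_frozen_tab:
  assumes "is_partition \<mu>" "\<forall>(i, j) \<in> young_diagram \<mu>. a + i + j \<le> n"
  shows "eg_tableau n (frozen_tab a \<mu>)"
  using assms
proof (induction \<mu> arbitrary: a)
  case Nil
  then show ?case by (simp add: eg_tableau_Nil)
next
  case (Cons k \<mu>)
  have k: "k \<noteq> 0" and \<mu>: "is_partition \<mu>" "\<forall>m \<in> set \<mu>. m \<le> k"
    using Cons.prems(1) by (auto simp: is_partition_Cons)
  have "a + 1 + i + j \<le> n" if "(i, j) \<in> young_diagram \<mu>" for i j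
  proof -
    have "(i + 1, j) \<in> young_diagram (k # \<mu>)"
      using that by (auto simp: young_diagram_Cons young_diagram_def)
    then show ?thesis using Cons.prems(2) by fastforce
  qed
  then have IH: "eg_tableau n (frozen_tab (a + 1) \<mu>)"
    using \<mu>(1) by (intro Cons.IH) auto
  have "(1, k) \<in> young_diagram (k # \<mu>)"
    using k by (simp add: young_diagram_Cons)
  then have "a + 1 + k \<le> n"
    using Cons.prems(2) by fastforce
  then have "reduced n (reading_word (frozen_tab (a + 1) \<mu>) @ [a + 1..<a + 1 + k])"
    using IH frozen_perm_le[of "a + 1" "a + 1" \<mu>] frozen_perm_gt[of "a + 1" _ \<mu>]
    by (intro reduced_append_upt) (auto simp: eg_tableau_def frozen_perm_def)
  moreover have "\<mu> = [] \<or> column_strict [a + 1..<a + 1 + k] (hd (frozen_tab (a + 1) \<mu>))"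
    using \<mu>(2) by (cases \<mu>) (auto simp: column_strict_def count_less_upt simp del: upt_Suc)
  moreover have "frozen_tab (a + 1) \<mu> = [] \<longleftrightarrow> \<mu> = []"
    by (cases \<mu>) auto
  ultimately show ?case
    using IH k by (auto simp: eg_tableau_Cons simp del: upt_Suc)
qed

text \<open>
  For \<open>c\<close> the position of the value \<open>a + i\<close>, the left-hand side says that the cell \<open>(a + i, a + j)\<close> lies in
  the Rothe diagram. In the columns up to \<open>k\<close> the first row of the tableau adds the row of the value
  \<open>a + 1\<close> and shifts the remaining diagram by one column, undoing the change of offset. Further right the
  permutation increases, so the diagram is empty there.
\<close>

lemma frozen_perm_diagram:
  assumes "is_partition \<mu>" "1 \<le> i" "1 \<le> j"
  shows "(\<exists>c > a + j. frozen_perm a \<mu> c = a + i \<and> a + i < frozen_perm a \<mu> (a + j)) \<longleftrightarrow>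
    (i, j) \<in> young_diagram \<mu>"
  using assms
proof (induction \<mu> arbitrary: a i)
  case Nil
  then show ?case by auto
next
  case (Cons k \<mu>)
  let ?\<sigma> = "frozen_perm a (k # \<mu>)" and ?\<tau> = "frozen_perm (a + 1) \<mu>"
  have \<mu>: "is_partition \<mu>" "\<forall>m \<in> set \<mu>. m \<le> k"
    using Cons.prems(1) by (auto simp: is_partition_Cons)
  have inj: "inj ?\<sigma>" unfolding frozen_perm_def by (rule word_perm_inj)
  have one: "?\<sigma> (a + k + 1) = a + 1"
    by (simp add: frozen_perm_Cons)
  show ?case
  proof (cases "j \<le> k")
    case False
    have "\<not> (?\<sigma> c = a + i \<and> a + i < ?\<sigma> (a + j))" if "a + j < c" for c
      using frozen_perm_increasing[OF Cons.prems(1), of k a "a + j" c] that False \<mu>(2) by auto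
    moreover have "(i, j) \<notin> young_diagram (k # \<mu>)"
    proof
      assume "(i, j) \<in> young_diagram (k # \<mu>)"
      then have "(1, j) \<in> young_diagram (k # \<mu>)"
        using is_partition_down[OF Cons.prems(1), of i j 1 j] Cons.prems by simp
      then show False using False by (simp add: young_diagram_Cons)
    qed
    ultimately show ?thesis by blast
  next
    case j: True
    show ?thesis
    proof (cases "i = 1")
      case True
      have "?\<sigma> (a + j) \<noteq> a + 1"
        using injD[OF inj, of "a + j" "a + k + 1"] one j by auto
      then have "a + 1 < ?\<sigma> (a + j)"
        using frozen_perm_gt[of a "a + j" "k # \<mu>"] Cons.prems(3) by simp
      then have "\<exists>c > a + j. ?\<sigma> c = a + i \<and> a + i < ?\<sigma> (a + j)"
        using one j True by (intro exI[of _ "a + k + 1"]) simp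
      then show ?thesis
        using True j Cons.prems(3) by (simp add: young_diagram_Cons)
    next
      case False
      then have i: "2 \<le> i" using Cons.prems(2) by simp
      have \<sigma>j: "?\<sigma> (a + j) = ?\<tau> (a + 1 + j)"
        using j Cons.prems(3) by (simp add: frozen_perm_Cons)
      have iff: "(\<exists>c > a + j. ?\<sigma> c = a + i) \<longleftrightarrow> (\<exists>c > a + 1 + j. ?\<tau> c = a + i)"
      proof
        assume "\<exists>c > a + j. ?\<sigma> c = a + i"
        then obtain c where c: "c > a + j" "?\<sigma> c = a + i" by blast
        then show "\<exists>c > a + 1 + j. ?\<tau> c = a + i"
          \<comment> \<open>The position of the value before the first row moved \<open>a + 1\<close> to the right.\<close>
          using i j by (intro exI[of _ "if c \<le> a + k then c + 1 else c"])
            (auto simp: frozen_perm_Cons split: if_splits)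
      next
        assume "\<exists>c > a + 1 + j. ?\<tau> c = a + i"
        then obtain c where c: "c > a + 1 + j" "?\<tau> c = a + i" by blast
        then show "\<exists>c > a + j. ?\<sigma> c = a + i"
          using i j by (intro exI[of _ "if c \<le> a + k + 1 then c - 1 else c"])
            (auto simp: frozen_perm_Cons split: if_splits)
      qed
      have "(\<exists>c > a + j. ?\<sigma> c = a + i \<and> a + i < ?\<sigma> (a + j)) \<longleftrightarrow>
          (\<exists>c > a + 1 + j. ?\<tau> c = a + 1 + (i - 1) \<and> a + 1 + (i - 1) < ?\<tau> (a + 1 + j))"
      proof -
        have "a + 1 + (i - 1) = a + i" using i by simp
        with iff show ?thesis
          unfolding \<sigma>j by auto
      qed
      also have "\<dots> \<longleftrightarrow> (i - 1, j) \<in> young_diagram \<mu>"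
        using i Cons.prems(3) by (intro Cons.IH \<mu>) auto
      also have "\<dots> \<longleftrightarrow> (i, j) \<in> young_diagram (k # \<mu>)"
        using i by (simp add: young_diagram_Cons)
      finally show ?thesis .
    qed
  qed
qed

section \<open>Permutations avoiding 132 have frozen insertion tableaux\<close>

text \<open>
  Splits off the longest frozen initial segment of a row.
\<close>

lemma sorted_wrt_upt_prefix:
  assumes "sorted_wrt (<) R" "\<forall>z \<in> set R. b \<le> z"
  shows "\<exists>p u. R = [b..<b + p] @ u \<and> (\<forall>z \<in> set u. b + p < (z :: nat))"
  using assms
proof (induction R arbitrary: b)
  case Nil
  show ?case by (intro exI[of _ 0] exI[of _ "[]"]) simp
next
  case (Cons x R)
  show ?case
  proof (cases "x = b")
    case True
    then obtain p u where "R = [b + 1..<b + 1 + p] @ u" "\<forall>z \<in> set u. b + 1 + p < z"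
      using Cons.IH[of "b + 1"] Cons.prems by (auto simp: Suc_le_eq simp del: upt_Suc)
    then show ?thesis
      using True by (intro exI[of _ "p + 1"] exI[of _ u]) (simp add: upt_conv_Cons del: upt_Suc)
  next
    case False
    then show ?thesis
      using Cons.prems by (intro exI[of _ 0] exI[of _ "x # R"]) fastforce
  qed
qed

text \<open>
  Strict columns raise the lower bound of the entries by one from row to row.
\<close>

lemma eg_tableau_letters_below:
  assumes "eg_tableau n (R # P)" "\<forall>z \<in> set R. a < z"
  shows "\<forall>z \<in> set (reading_word P). a + 1 < z"
  using assms
proof (induction P arbitrary: R a)
  case (Cons S P)
  have S: "\<forall>z \<in> set S. a + 1 < z"
  proof
    fix z assume "z \<in> set S"
    then obtain y where "y \<in> set R" "y < z"
      using Cons.prems(1) column_strict_mem[of R S z] by (auto simp: eg_tableau_Cons)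
    then show "a + 1 < z" using Cons.prems(2) by fastforce
  qed
  moreover have "\<forall>z \<in> set (reading_word P). a + 1 + 1 < z"
    using Cons.prems(1) S by (intro Cons.IH[of S]) (simp add: eg_tableau_Cons)
  ultimately show ?case by auto
qed simp

text \<open>
  Let the first row be \<open>a + 1, \<dots>, a + p\<close> followed by \<open>u\<close>. Then the value \<open>a + 1\<close> stands at position
  \<open>a + p + 1\<close>, all entries to its right are larger, and a last letter of \<open>u\<close> would be a descent among
  them. So \<open>u\<close> is empty. The lower rows then belong to the permutation with \<open>a + 1\<close> put back to position
  \<open>a + 1\<close>, which keeps the relative order of all other entries and hence the avoidance.
\<close>

lemma eg_tableau_avoiding_frozen:
  assumes "eg_tableau n P" "\<forall>z \<in> set (reading_word P). a < z"
    and "\<And>i j l. a < i \<Longrightarrow> i < j \<Longrightarrow> j < l \<Longrightarrow> l \<le> n \<Longrightarrow>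
      word_perm (reading_word P) i < word_perm (reading_word P) l \<Longrightarrow>
      \<not> word_perm (reading_word P) l < word_perm (reading_word P) j"
  shows "P = frozen_tab a (tab_shape P)"
  using assms
proof (induction P arbitrary: a)
  case Nil
  then show ?case by simp
next
  case (Cons R P)
  let ?b = "a + 1" and ?\<sigma> = "word_perm (reading_word (R # P))" and ?\<tau> = "word_perm (reading_word P)"
  have RP: "eg_tableau n P" "reduced n (reading_word P @ R)" "sorted_wrt (<) R"
    using Cons.prems(1) by (auto simp: eg_tableau_Cons)
  have P: "\<forall>z \<in> set (reading_word P). ?b < z"
    using Cons.prems by (intro eg_tableau_letters_below) auto
  have "\<forall>z \<in> set R. ?b \<le> z"
    using Cons.prems(2) by (auto simp: Suc_le_eq)
  then obtain p u where R: "R = [?b..<?b + p] @ u" and u: "\<forall>z \<in> set u. ?b + p < z"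
    using sorted_wrt_upt_prefix[OF RP(3)] by blast
  have "u = []"
  proof (rule ccontr)
    assume "u \<noteq> []"
    then obtain u' l where u': "u = u' @ [l]" by (cases u rule: rev_cases) auto
    define V where "V = reading_word P @ [?b..<?b + p] @ u'"
    have word: "reading_word (R # P) = V @ [l]"
      by (simp add: V_def R u')
    have red: "reduced n (V @ [l])"
      using RP(2) word by simp
    then have l: "l \<in> {1..n - 1}"
      using reduced_letters by fastforce
    have "word_perm V l < word_perm V (l + 1)"
      using red reduced_snoc[OF l] by blast
    then have desc: "?\<sigma> (l + 1) < ?\<sigma> l"
      by (simp add: word word_perm_snoc del: reading_word_Cons)
    have "?\<sigma> (?b + p) = ?\<tau> (word_perm [?b..<?b + p] (word_perm u (?b + p)))"
      by (simp add: R word_perm_append del: upt_Suc)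
    also have "word_perm u (?b + p) = ?b + p"
      using u by (intro word_perm_le) auto
    also have "word_perm [?b..<?b + p] (?b + p) = ?b"
      by (subst word_perm_upt) simp
    also have "?\<tau> ?b = ?b"
      using P by (intro word_perm_le) auto
    finally have min: "?\<sigma> (?b + p) = ?b" .
    have "?b + p < l" using u u' by simp
    then have "?\<sigma> (l + 1) \<noteq> ?\<sigma> (?b + p)"
      using injD[OF word_perm_inj, of "reading_word (R # P)" "l + 1" "?b + p"] by auto
    moreover have "a < ?\<sigma> (l + 1)"
      using Cons.prems(2) \<open>?b + p < l\<close> by (intro word_perm_gt) auto
    ultimately have "?\<sigma> (?b + p) < ?\<sigma> (l + 1)"
      using min by simp
    moreover have "l + 1 \<le> n"
      using l by auto
    ultimately show False
      using Cons.prems(3)[of "?b + p" l "l + 1"] desc \<open>?b + p < l\<close> by simp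
  qed
  then have \<sigma>: "?\<sigma> i = ?\<tau> (word_perm [?b..<?b + p] i)" for i
    by (simp add: R word_perm_append del: upt_Suc)
  have "P = frozen_tab (a + 1) (tab_shape P)"
  proof (rule Cons.IH[OF RP(1) P])
    fix i j l assume *: "a + 1 < i" "i < j" "j < l" "l \<le> n" "?\<tau> i < ?\<tau> l"
    \<comment> \<open>The position of an entry after the value \<open>a + 1\<close> has been moved to the right past it.\<close>
    define q where "q x = (if x \<le> ?b + p then x - 1 else x)" for x
    have q: "?\<sigma> (q x) = ?\<tau> x" if "a + 1 < x" for x
      unfolding \<sigma> word_perm_upt q_def using that by auto
    have "\<not> ?\<sigma> (q l) < ?\<sigma> (q j)"
    proof (rule Cons.prems(3))
      show "?\<sigma> (q i) < ?\<sigma> (q l)" using * q[of i] q[of l] by (simp del: reading_word_Cons)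
    qed (use * in \<open>auto simp: q_def\<close>)
    then show "\<not> ?\<tau> l < ?\<tau> j"
      using * q[of j] q[of l] by (simp del: reading_word_Cons)
  qed
  then show ?case
    using \<open>u = []\<close> R by simp
qed


section \<open>Permutations avoiding 132 and partitions in the staircase\<close>

text \<open>
  Every cell is joined to the corner by a hook through the first column.
\<close>

lemma corner_component_young_diagram:
  assumes "is_partition \<mu>"
  shows "corner_component (young_diagram \<mu>) = young_diagram \<mu>"
proof
  let ?Y = "young_diagram \<mu>"
  show "corner_component ?Y \<subseteq> ?Y" by (rule corner_component_subset)
  show "?Y \<subseteq> corner_component ?Y"
  proof (rule subrelI)
    fix r c assume rc: "(r, c) \<in> ?Y"
    let ?E = "{(a, b). a \<in> ?Y \<and> b \<in> ?Y \<and> adjacent a b}"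
    have pos: "1 \<le> r" "1 \<le> c" using rc by (auto simp: young_diagram_def)
    have box: "(p, q) \<in> ?Y" if "1 \<le> p" "p \<le> r" "1 \<le> q" "q \<le> c" for p q
      using is_partition_down[OF assms rc] that by simp
    have "((1, 1), (p, 1)) \<in> ?E\<^sup>*" if "1 \<le> p" "p \<le> r" for p
      using that
    proof (induction p rule: dec_induct)
      case (step p)
      have "((p, 1), (Suc p, 1)) \<in> ?E"
        using step pos box[of p 1] box[of "Suc p" 1] by (simp add: adjacent_def)
      with step show ?case by (simp add: rtrancl.rtrancl_into_rtrancl)
    qed simp
    from this[of r] have "((1, 1), (r, 1)) \<in> ?E\<^sup>*" using pos by simp
    moreover have "((r, 1), (r, q)) \<in> ?E\<^sup>*" if "1 \<le> q" "q \<le> c" for q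
      using that
    proof (induction q rule: dec_induct)
      case (step q)
      have "((r, q), (r, Suc q)) \<in> ?E"
        using step pos box[of r q] box[of r "Suc q"] by (simp add: adjacent_def)
      with step show ?case by (simp add: rtrancl.rtrancl_into_rtrancl)
    qed simp
    from this[of c] have "((r, 1), (r, c)) \<in> ?E\<^sup>*" using pos by simp
    ultimately have "((1, 1), (r, c)) \<in> ?E\<^sup>*" by (rule rtrancl_trans)
    then show "(r, c) \<in> corner_component ?Y"
      using box[of 1 1] pos by (simp add: corner_component_def)
  qed
qed

lemma young_diagram_staircase:
  "(i, j) \<in> young_diagram (staircase n) \<longleftrightarrow> 1 \<le> i \<and> 1 \<le> j \<and> i + j \<le> n"
proof -
  have "staircase n ! (i - 1) = n - i" if "1 \<le> i" "i \<le> n - 1"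
    using that by (simp add: staircase_def rev_nth)
  then show ?thesis
    by (auto simp: young_diagram_def) (auto simp: staircase_def)
qed

lemma partitions_in_staircase_iff:
  "\<mu> \<in> partitions_in_staircase n \<longleftrightarrow>
     is_partition \<mu> \<and> (\<forall>(i, j) \<in> young_diagram \<mu>. i + j \<le> n)"
  unfolding partitions_in_staircase_def
  by (auto simp: subset_iff young_diagram_staircase) (auto simp: young_diagram_def)

lemma eg_tableau_frozen_tab_staircase:
  assumes "\<mu> \<in> partitions_in_staircase n"
  shows "eg_tableau n (frozen_tab 0 \<mu>)"
  using assms by (intro eg_tableau_frozen_tab) (auto simp: partitions_in_staircase_iff)

lemma frozen_perm_perms_132:
  assumes "\<mu> \<in> partitions_in_staircase n"
  shows "frozen_perm 0 \<mu> \<in> perms_132 n"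
proof -
  have "frozen_perm 0 \<mu> permutes {1..n}"
    unfolding frozen_perm_def using eg_tableau_frozen_tab_staircase[OF assms]
    by (intro word_perm_permutes reduced_letters) (simp add: eg_tableau_def)
  moreover have "avoids_132 n (frozen_perm 0 \<mu>)"
    unfolding avoids_132_def
  proof clarify
    fix i j k assume "1 \<le> i" "i < j" "j < k"
      "frozen_perm 0 \<mu> i < frozen_perm 0 \<mu> k" "frozen_perm 0 \<mu> k < frozen_perm 0 \<mu> j"
    then show False
      using frozen_perm_avoids[of \<mu> 0 i j k] assms by (simp add: partitions_in_staircase_iff)
  qed
  ultimately show ?thesis
    by (simp add: perms_132_def)
qed

lemma lambda_shape_frozen_perm:
  assumes "\<mu> \<in> partitions_in_staircase n"
  shows "lambda_shape n (frozen_perm 0 \<mu>) = \<mu>"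
proof -
  let ?\<sigma> = "frozen_perm 0 \<mu>"
  have \<mu>: "is_partition \<mu>" "\<And>i j. (i, j) \<in> young_diagram \<mu> \<Longrightarrow> 1 \<le> i \<and> 1 \<le> j \<and> i + j \<le> n"
    using assms by (auto simp: partitions_in_staircase_iff young_diagram_def)
  have perm: "?\<sigma> permutes {1..n}"
    using frozen_perm_perms_132[OF assms] by (simp add: perms_132_def)
  have "rothe_diagram n ?\<sigma> = young_diagram \<mu>"
  proof (intro set_eqI)
    fix x :: "nat \<times> nat"
    obtain r c where x: "x = (r, c)" by (cases x)
    have "(r, c) \<in> rothe_diagram n ?\<sigma> \<longleftrightarrow>
        1 \<le> r \<and> r \<le> n \<and> 1 \<le> c \<and> c \<le> n \<and> (\<exists>d > c. ?\<sigma> d = r \<and> r < ?\<sigma> c)"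
      unfolding rothe_diagram_def using permutes_inverses[OF perm] by auto
    also have "\<dots> \<longleftrightarrow> 1 \<le> r \<and> r \<le> n \<and> 1 \<le> c \<and> c \<le> n \<and> (r, c) \<in> young_diagram \<mu>"
      using frozen_perm_diagram[OF \<mu>(1), of r c 0] by auto
    also have "\<dots> \<longleftrightarrow> (r, c) \<in> young_diagram \<mu>"
      using \<mu>(2)[of r c] by auto
    finally show "x \<in> rothe_diagram n ?\<sigma> \<longleftrightarrow> x \<in> young_diagram \<mu>"
      by (simp add: x)
  qed
  then have "young_diagram (lambda_shape n ?\<sigma>) = young_diagram \<mu>"
    using lambda_shape(2)[OF perm] corner_component_young_diagram[OF \<mu>(1)] by simp
  then show ?thesis
    by (rule young_diagram_inj[OF lambda_shape(1)[OF perm] \<mu>(1)])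
qed

text \<open>
  The insertion tableau is frozen, and a frozen tableau is determined by its shape. So the shape of the
  insertion tableau determines the permutation, whose diagram in turn gives back the shape.
\<close>

lemma perms_132_P_tab:
  assumes "\<sigma> \<in> perms_132 n" "w \<in> reduced_words n \<sigma>"
  shows "lambda_shape n \<sigma> \<in> partitions_in_staircase n"
    and "P_tab w = frozen_tab 0 (lambda_shape n \<sigma>)"
    and "\<sigma> = frozen_perm 0 (lambda_shape n \<sigma>)"
proof -
  define P \<mu> where "P = P_tab w" and "\<mu> = tab_shape P"
  have w: "word_perm w = \<sigma>" "reduced n w"
    using assms(2) by (auto simp: reduced_def reduced_words_def)
  have P: "eg_tableau n P" and perm: "word_perm (reading_word P) = \<sigma>"
    using eg_tableau_P_tab[OF w(2)] word_perm_P_tab[OF w(2)] w(1) by (simp_all add: P_def)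
  have letters: "set (reading_word P) \<subseteq> {1..n - 1}"
    using P by (intro reduced_letters) (simp add: eg_tableau_def)
  have "avoids_132 n \<sigma>"
    using assms(1) by (simp add: perms_132_def)
  have frozen: "P = frozen_tab 0 \<mu>"
    unfolding \<mu>_def
  proof (rule eg_tableau_avoiding_frozen[OF P])
    show "\<forall>z \<in> set (reading_word P). 0 < z"
      using letters by auto
    fix i j l assume *: "0 < i" "i < j" "j < l" "l \<le> n"
      "word_perm (reading_word P) i < word_perm (reading_word P) l"
    show "\<not> word_perm (reading_word P) l < word_perm (reading_word P) j"
    proof
      assume "word_perm (reading_word P) l < word_perm (reading_word P) j"
      then have "\<exists>i j k. 1 \<le> i \<and> i < j \<and> j < k \<and> k \<le> n \<and> \<sigma> i < \<sigma> k \<and> \<sigma> k < \<sigma> j"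
        using * by (intro exI[of _ i] exI[of _ j] exI[of _ l]) (simp add: perm)
      then show False
        using \<open>avoids_132 n \<sigma>\<close> by (simp only: avoids_132_def simp_thms)
    qed
  qed
  then have \<sigma>: "\<sigma> = frozen_perm 0 \<mu>"
    using perm by (simp add: frozen_perm_def)
  have "i + j \<le> n" if "(i, j) \<in> young_diagram \<mu>" for i j
  proof -
    have "0 + i + j - 1 \<in> set (reading_word P)"
      unfolding frozen set_reading_word_frozen_tab using that by blast
    then have "i + j - 1 \<in> {1..n - 1}"
      using letters by auto
    then show ?thesis by auto
  qed
  then have \<mu>: "\<mu> \<in> partitions_in_staircase n"
    using is_partition_tab_shape[OF P] by (auto simp: partitions_in_staircase_iff \<mu>_def)
  then have "lambda_shape n \<sigma> = \<mu>"
    using lambda_shape_frozen_perm \<sigma> by simp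
  then show "lambda_shape n \<sigma> \<in> partitions_in_staircase n"
    "P_tab w = frozen_tab 0 (lambda_shape n \<sigma>)" "\<sigma> = frozen_perm 0 (lambda_shape n \<sigma>)"
    using \<mu> frozen \<sigma> by (simp_all add: P_def)
qed

lemma perms_132_lambda_shape:
  assumes "\<sigma> \<in> perms_132 n"
  shows "lambda_shape n \<sigma> \<in> partitions_in_staircase n"
    and "\<sigma> = frozen_perm 0 (lambda_shape n \<sigma>)"
proof -
  obtain w where "w \<in> reduced_words n \<sigma>"
    using assms reduced_word_exists by (auto simp: perms_132_def)
  with assms show "lambda_shape n \<sigma> \<in> partitions_in_staircase n"
    and "\<sigma> = frozen_perm 0 (lambda_shape n \<sigma>)"
    by (rule perms_132_P_tab)+
qed

text \<open>
  This identifies the reduced words of a 132-avoiding permutation with a single fibre of the insertion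
  tableau, to which the Edelman--Greene correspondence applies.
\<close>

lemma reduced_words_perms_132:
  assumes "\<sigma> \<in> perms_132 n"
  shows "reduced_words n \<sigma> = {w. reduced n w \<and> P_tab w = frozen_tab 0 (lambda_shape n \<sigma>)}"
proof (intro set_eqI iffI)
  fix w assume "w \<in> reduced_words n \<sigma>"
  then show "w \<in> {w. reduced n w \<and> P_tab w = frozen_tab 0 (lambda_shape n \<sigma>)}"
    using perms_132_P_tab(2)[OF assms] by (auto simp: reduced_def reduced_words_def)
next
  fix w assume "w \<in> {w. reduced n w \<and> P_tab w = frozen_tab 0 (lambda_shape n \<sigma>)}"
  then have w: "reduced n w" "P_tab w = frozen_tab 0 (lambda_shape n \<sigma>)" by simp_all
  then have "word_perm w = frozen_perm 0 (lambda_shape n \<sigma>)"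
    using word_perm_P_tab[OF w(1)] by (simp add: frozen_perm_def)
  then show "w \<in> reduced_words n \<sigma>"
    using w(1) perms_132_lambda_shape(2)[OF assms] by (simp add: reduced_def)
qed

lemma bij_betw_lambda_shape:
  "bij_betw (lambda_shape n) (perms_132 n) (partitions_in_staircase n)"
  by (rule bij_betw_byWitness[where f' = "frozen_perm 0"])
    (use perms_132_lambda_shape lambda_shape_frozen_perm frozen_perm_perms_132 in auto)

lemma bij_betw_EG_perms_132:
  assumes "\<sigma> \<in> perms_132 n"
  shows "bij_betw EG (reduced_words n \<sigma>) (SYT (lambda_shape n \<sigma>))"
  using EG_bij_betw[OF eg_tableau_frozen_tab_staircase[OF perms_132_lambda_shape(1)[OF assms]]]
  by (simp add: reduced_words_perms_132[OF assms])

theorem corollary3p9: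
  fixes n :: nat
  shows "(\<forall>\<sigma> \<in> perms_132 n. \<forall>w \<in> reduced_words n \<sigma>.
            frozen (P_tab w) \<and> tab_shape (P_tab w) = lambda_shape n \<sigma>) \<and>
         (\<forall>\<mu> \<in> partitions_in_staircase n.
            \<exists>!\<sigma>. \<sigma> \<in> perms_132 n \<and> lambda_shape n \<sigma> = \<mu>) \<and>
         (\<forall>\<sigma> \<in> perms_132 n.
            bij_betw EG (reduced_words n \<sigma>) (SYT (lambda_shape n \<sigma>))) \<and>
         bij_betw EG (\<Union>\<sigma> \<in> perms_132 n. reduced_words n \<sigma>)
           (\<Union>\<mu> \<in> partitions_in_staircase n. SYT \<mu>)"
proof (intro conjI ballI)
  fix \<sigma> w assume "\<sigma> \<in> perms_132 n" "w \<in> reduced_words n \<sigma>"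
  then have "P_tab w = frozen_tab 0 (lambda_shape n \<sigma>)" by (rule perms_132_P_tab)
  then show "frozen (P_tab w)" "tab_shape (P_tab w) = lambda_shape n \<sigma>"
    by (simp_all add: frozen_frozen_tab)
next
  fix \<mu> assume "\<mu> \<in> partitions_in_staircase n"
  then show "\<exists>!\<sigma>. \<sigma> \<in> perms_132 n \<and> lambda_shape n \<sigma> = \<mu>"
    using lambda_shape_frozen_perm frozen_perm_perms_132 perms_132_lambda_shape(2) by metis
next
  fix \<sigma> assume "\<sigma> \<in> perms_132 n"
  then show "bij_betw EG (reduced_words n \<sigma>) (SYT (lambda_shape n \<sigma>))"
    by (rule bij_betw_EG_perms_132)
next
  have "bij_betw EG (\<Union>\<sigma> \<in> perms_132 n. reduced_words n \<sigma>)
      (\<Union>\<sigma> \<in> perms_132 n. SYT (lambda_shape n \<sigma>))"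
  proof (rule bij_betw_UNION_disjoint)
    show "disjoint_family_on (\<lambda>\<sigma>. SYT (lambda_shape n \<sigma>)) (perms_132 n)"
      unfolding disjoint_family_on_def
    proof (intro ballI impI)
      fix \<sigma> \<tau> assume "\<sigma> \<in> perms_132 n" "\<tau> \<in> perms_132 n" "\<sigma> \<noteq> \<tau>"
      then have "lambda_shape n \<sigma> \<noteq> lambda_shape n \<tau>"
        using perms_132_lambda_shape(2) by metis
      then show "SYT (lambda_shape n \<sigma>) \<inter> SYT (lambda_shape n \<tau>) = {}"
        by (auto simp: SYT_def)
    qed
  qed (rule bij_betw_EG_perms_132)
  also have "(\<Union>\<sigma> \<in> perms_132 n. SYT (lambda_shape n \<sigma>)) = (\<Union>\<mu> \<in> partitions_in_staircase n. SYT \<mu>)"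
    using bij_betw_imp_surj_on[OF bij_betw_lambda_shape[of n]] by (simp flip: image_image)
  finally show "bij_betw EG (\<Union>\<sigma> \<in> perms_132 n. reduced_words n \<sigma>)
      (\<Union>\<mu> \<in> partitions_in_staircase n. SYT \<mu>)" .
qed

end
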